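(* Let $(\mu,\nu)\in\mathcal{P}(\mathsf{X})\times\mathcal{P}(\mathsf{Y})$ and $R\in\mathcal{P}(\mathsf{X}\times\mathsf{Y})$. Suppose that $R\sim P:=\mu\otimes\nu$ and that the density $dR/dP$ admits a continuous version. Then there exists a unique coupling $\pi\in\Pi(\mu,\nu)$ such that $(\pi,R)$ is cyclically invariant. If the static Schrödinger bridge problem $$\inf_{\pi'\in\Pi(\mu,\nu)} H(\pi'|R)$$ is finite, then $\pi$ is its minimizer.
   Context: $(\mathsf{X},d)$ and $(\mathsf{Y},d)$ are complete separable metric spaces; $\mathsf{X}\times\mathsf{Y}$ carries the metric $d((x,y),(x',y'))=\max\{d(x,x'),d(y,y')\}$. $\mathcal{P}(\cdot)$ denotes the Borel probability measures, $\Pi(\mu,\nu)$ the set of couplings, i.e. probability measures on $\mathsf{X}\times\mathsf{Y}$ with first marginal $\mu$ and second marginal $\nu$. $B_r(x)$ is the open ball of radius $r$ around $x$; $\sim$ denotes mutual absolute continuity. Standing assumption (differentiation of measures): given $\rho,\lambda\in\mathcal{P}(\mathsf{X})$ with $\rho\ll\lambda$, there exists $\mathsf{X}'\subset\mathsf{X}$ of full $\lambda$-measure such that $f(x):=\lim_{r\to0}\rho(B_r(x))/\lambda(B_r(x))$, $x\in\mathsf{X}'$, defines a version of the Radon–Nikodym density $d\rho/d\lambda$. The analogous property is assumed on $\mathsf{X}\times\mathsf{Y}$. Relative entropy: $H(\pi|R):=\int\log(\frac{d\pi}{dR})\,d\pi$ if $\pi\ll R$ and $H(\pi|R):=\infty$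 otherwise. The problem is finite if there exists $\pi_0\in\Pi(\mu,\nu)$ with $H(\pi_0|R)<\infty$. Definition: for $\pi\in\Pi(\mu,\nu)$ and $R\in\mathcal{P}(\mathsf{X}\times\mathsf{Y})$, the pair $(\pi,R)$ is cyclically invariant if $\pi\sim R\sim\mu\otimes\nu$ and there exists a version $d\pi/dR:\mathsf{X}\times\mathsf{Y}\to(0,\infty)$ of the relative density satisfying $$\prod_{i=1}^{k} \frac{d\pi}{dR}(x_{i},y_{i})=\prod_{i=1}^{k} \frac{d\pi}{dR}(x_{i},y_{i+1})$$ for all $k\in\mathbb{N}$ and $(x_i,y_i)_{i=1}^k\subset\mathsf{X}\times\mathsf{Y}$, where $y_{k+1}:=y_1$. *)

theory Defs
  imports "HOL-Probability.Probability"
begin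

definition borel_probs :: "'a::topological_space measure set" where
  "borel_probs = {M. prob_space M \<and> sets M = sets borel}"

text \<open>On second countable spaces, the pair sigma-algebra underlying
  \<open>\<mu> \<Otimes>\<^sub>M \<nu>\<close> is the Borel sigma-algebra of the product (\<open>borel_prod\<close>).\<close>

definition couplings :: "'a::topological_space measure \<Rightarrow> 'b::topological_space measure
    \<Rightarrow> ('a \<times> 'b) measure set" where
  "couplings \<mu> \<nu> =
     {\<pi> \<in> borel_probs. distr \<pi> borel fst = \<mu> \<and> distr \<pi> borel snd = \<nu>}"

text \<open>In the library, \<open>absolutely_continuous M N\<close> means \<open>N\<close> is absolutely
  continuous with respect to \<open>M\<close>.\<close>

definition mutually_ac :: "'a measure \<Rightarrow> 'a measure \<Rightarrow> bool" where
  "mutually_ac M N \<longleftrightarrow> absolutely_continuous M N \<and> absolutely_continuous N M"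

text \<open>\<open>f\<close> is a real-valued version of the density of \<open>\<rho>\<close> with respect to \<open>\<tau>\<close>.
  Nonnegativity is stated separately because \<open>ennreal\<close> truncates negative values.\<close>

definition density_version :: "('a \<Rightarrow> real) \<Rightarrow> 'a measure \<Rightarrow> 'a measure \<Rightarrow> bool" where
  "density_version f \<rho> \<tau> \<longleftrightarrow>
     f \<in> borel_measurable \<tau> \<and> (AE x in \<tau>. 0 \<le> f x) \<and>
     density \<tau> (\<lambda>x. ennreal (f x)) = \<rho>"

text \<open>The library metric on a product type is the Euclidean combination of the
  two distances; the balls used here are those of the maximum metric, which
  induces the same topology.\<close>

definition max_ball :: "'a::metric_space \<times> 'b::metric_space \<Rightarrow> real \<Rightarrow> ('a \<times> 'b) set" where
  "max_ball p r = {q. max (dist (fst p) (fst q)) (dist (snd p) (snd q)) < r}"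

text \<open>Differentiation of measures with respect to the balls \<open>B x r\<close>. The density may be
  given any values off the full-measure set \<open>S\<close>. The quotient only makes sense where
  small balls have positive mass, so points of \<open>S\<close> are required to satisfy this;
  in a separable metric space this discards only a null set.\<close>

definition differentiation_of_measures ::
    "('a::topological_space \<Rightarrow> real \<Rightarrow> 'a set) \<Rightarrow> bool" where
  "differentiation_of_measures B \<longleftrightarrow>
     (\<forall>\<rho>\<in>borel_probs. \<forall>\<tau>\<in>borel_probs. absolutely_continuous \<tau> \<rho> \<longrightarrow>
        (\<exists>S f. S \<in> sets \<tau> \<and> measure \<tau> S = 1 \<and>
           (\<forall>x\<in>S. (\<forall>r>0. 0 < measure \<tau> (B x r)) \<and>
              ((\<lambda>r. measure \<rho> (B x r) / measure \<tau> (B x r)) \<longlongrightarrow> f x) (at_right 0)) \<and>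
           density_version f \<rho> \<tau>))"

text \<open>For probability measures the negative part of the logarithmic density has finite
  \<open>\<pi>\<close>-integral, so the difference below is never \<open>\<infinity> - \<infinity>\<close>. The library's
  \<open>KL_divergence\<close> is not used because a Bochner integral is \<open>0\<close>, not \<open>\<infinity>\<close>,
  when the integrand is not integrable.\<close>

definition relative_entropy :: "'a measure \<Rightarrow> 'a measure \<Rightarrow> ereal" where
  "relative_entropy \<pi> R =
     (if absolutely_continuous R \<pi> then
        enn2ereal (\<integral>\<^sup>+z. ennreal (ln (enn2real (RN_deriv R \<pi> z))) \<partial>\<pi>) -
        enn2ereal (\<integral>\<^sup>+z. ennreal (- ln (enn2real (RN_deriv R \<pi> z))) \<partial>\<pi>)
      else \<infinity>)"

definition bridge_value :: "'a::topological_space measure \<Rightarrow> 'b::topological_space measure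
    \<Rightarrow> ('a \<times> 'b) measure \<Rightarrow> ereal" where
  "bridge_value \<mu> \<nu> R = (INF \<pi>\<in>couplings \<mu> \<nu>. relative_entropy \<pi> R)"

definition bridge_finite :: "'a::topological_space measure \<Rightarrow> 'b::topological_space measure
    \<Rightarrow> ('a \<times> 'b) measure \<Rightarrow> bool" where
  "bridge_finite \<mu> \<nu> R \<longleftrightarrow> (\<exists>\<pi>\<in>couplings \<mu> \<nu>. relative_entropy \<pi> R < \<infinity>)"

definition bridge_minimizers :: "'a::topological_space measure \<Rightarrow> 'b::topological_space measure
    \<Rightarrow> ('a \<times> 'b) measure \<Rightarrow> ('a \<times> 'b) measure set" where
  "bridge_minimizers \<mu> \<nu> R =
     {\<pi> \<in> couplings \<mu> \<nu>. relative_entropy \<pi> R = bridge_value \<mu> \<nu> R}"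

definition cyclically_invariant :: "'a measure \<Rightarrow> 'b measure
    \<Rightarrow> ('a \<times> 'b) measure \<Rightarrow> ('a \<times> 'b) measure \<Rightarrow> bool" where
  "cyclically_invariant \<mu> \<nu> \<pi> R \<longleftrightarrow>
     mutually_ac \<pi> R \<and> mutually_ac R (\<mu> \<Otimes>\<^sub>M \<nu>) \<and>
     (\<exists>f. density_version f \<pi> R \<and> (\<forall>z. 0 < f z) \<and>
        (\<forall>(k::nat) x y.
           (\<Prod>i=1..k. f (x i, y i)) =
           (\<Prod>i=1..k. f (x i, if i = k then y 1 else y (i + 1)))))"

end

theory Submission
  imports Defs
begin

text \<open>
Write \<open>P\<close> for \<open>\<mu> \<Otimes>\<^sub>M \<nu>\<close> and let \<open>h > 0\<close> be the density of \<open>R\<close> with respect to \<open>P\<close>. For couplings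
equivalent to \<open>R\<close>, cyclic invariance means that the density factorises, \<open>d\<pi>/dR = f(x) g(y)\<close>. So the
task is to find positive \<open>f\<close> and \<open>g\<close> such that \<open>f(x) g(y) h(x, y) P\<close> has the marginals \<open>\<mu>\<close> and \<open>\<nu>\<close>, to
show that the resulting measure is unique, and to show that it minimises the entropy.

The heart of the proof is an algebraic identity. For two scalings \<open>(f, g)\<close> and \<open>(f', g')\<close> put
\<open>\<tau> = (f - f') / (f + f')\<close> and \<open>\<sigma> = (g - g') / (g + g')\<close>. Then
\<open>(\<tau>(x) + \<sigma>(y)) (f g - f' g') = 2 (f g - f' g')\<^sup>2 / ((f + f') (g + g'))\<close>. Integrated against \<open>h P\<close>, the
left-hand side only involves bounded functions of one variable, so it is controlled by the marginals of
the two scaled measures (\<open>scaled_difference_bound\<close>). If both are couplings of \<open>\<mu>\<close> and \<open>\<nu>\<close>, it vanishes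
and the two coincide (\<open>scaling_unique\<close>). If both are nearly couplings, it is small, and this yields
convergence of approximate solutions.

Existence starts from the equations \<open>f (e + \<integral> h g d\<nu>) = 1\<close> and \<open>g (e + \<integral> h f d\<mu>) = 1\<close>, which a monotone
iteration solves for every \<open>e > 0\<close> (\<open>regularised_exists\<close>). The marginals of \<open>f g h P\<close> are then dominated
by \<open>\<mu>\<close> and \<open>\<nu>\<close>, and its mass tends to \<open>1\<close> with \<open>e \<rightarrow> 0\<close> (\<open>regularised_mass_tendsto\<close>). After moving a
constant from one factor to the other, both factors are bounded by functions that depend only on \<open>h\<close>
(\<open>uniform_scaling_bounds\<close>), so the identity makes the products \<open>f g\<close> Cauchy in a weighted \<open>L\<^sup>1\<close> space
(\<open>subscalings_converge\<close>). Their almost everywhere limit has the right marginals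
(\<open>limit_of_subscalings\<close>) and is itself a product (\<open>scaling_exists\<close>).

For minimality, \<open>ln (d\<pi>/dR) = ln f + ln g\<close> formally has the same integral against every coupling, so that
\<open>H(\<pi>'|R) = H(\<pi>'|\<pi>) + H(\<pi>|R)\<close>. The summands need not be integrable, and \<open>entropy_gap\<close> obtains the
inequality \<open>\<ge>\<close> from truncations and Fatou's lemma; equality of the entropies then forces \<open>\<pi>' = \<pi>\<close>.
\<close>

section \<open>Quantiles and lower bounds in probability spaces\<close>

text \<open>A positive function is, off a set of small measure, bounded below by a constant. This is the only
form in which positivity of the kernel ever enters a quantitative estimate.\<close>

lemma (in prob_space) positive_bounded_below:
  fixes f :: "'a \<Rightarrow> real"
  assumes [measurable]: "f \<in> borel_measurable M" and pos: "\<And>x. x \<in> space M \<Longrightarrow> 0 < f x" and "0 < \<delta>"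
  obtains n :: nat where "prob {x\<in>space M. f x < inverse (real (Suc n))} < \<delta>"
proof -
  let ?B = "\<lambda>n. {x\<in>space M. f x < inverse (real (Suc n))}"
  have "(\<lambda>n. prob (?B n)) \<longlonglongrightarrow> prob (\<Inter>n. ?B n)"
  proof (intro finite_Lim_measure_decseq)
    have "inverse (real (Suc n)) \<le> inverse (real (Suc m))" if "m \<le> n" for m n
      using that by (intro le_imp_inverse_le) auto
    then show "decseq ?B"
      unfolding decseq_def by (blast intro: less_le_trans)
  qed auto
  also have "(\<Inter>n. ?B n) = {}"
  proof -
    have "\<exists>n. \<not> f x < inverse (real (Suc n))" if "x \<in> space M" for x
      using reals_Archimedean[OF pos[OF that]] by (blast intro: less_asym)
    then show ?thesis by blast
  qed
  finally have "eventually (\<lambda>n. prob (?B n) < \<delta>) sequentially"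
    by (rule order_tendstoD) (simp add: \<open>0 < \<delta>\<close>)
  then obtain n where "prob (?B n) < \<delta>"
    unfolding eventually_sequentially by blast
  then show thesis by (rule that)
qed

text \<open>The level \<open>t\<close> serves as an upper quartile of \<open>f\<close>. It is the largest dyadic multiple of a small constant
that \<open>f\<close> still exceeds with probability \<open>1/4\<close>; searching along powers of \<open>2\<close> avoids any continuity
consideration for the distribution of \<open>f\<close>, at the price of the factor \<open>2\<close> in the second estimate.\<close>

lemma (in prob_space) dyadic_quantile:
  fixes f :: "'a \<Rightarrow> real"
  assumes [measurable]: "f \<in> borel_measurable M" and pos: "\<And>x. x \<in> space M \<Longrightarrow> 0 < f x"
  obtains t where "0 < t" "1/4 \<le> prob {x\<in>space M. t \<le> f x}" "prob {x\<in>space M. 2 * t < f x} \<le> 1/4"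
proof -
  obtain n0 :: nat where "prob {x\<in>space M. f x < inverse (real (Suc n0))} < 3/4"
    using positive_bounded_below[of f "3/4"] pos by auto
  moreover have "prob {x\<in>space M. \<not> f x < inverse (real (Suc n0))}
      = 1 - prob {x\<in>space M. f x < inverse (real (Suc n0))}"
    by (rule prob_neg) measurable
  ultimately have n0: "prob {x\<in>space M. inverse (real (Suc n0)) \<le> f x} > 1/4"
    by (simp add: not_less)
  \<comment> \<open>The search starts at a level that is exceeded with probability more than \<open>1/4\<close>.\<close>
  define c where "c = inverse (real (Suc n0))"
  have c: "0 < c" by (simp add: c_def)
  define E where "E n = {x\<in>space M. 2 ^ n * c \<le> f x}" for n :: nat
  have dec: "decseq E"
  proof -
    have "2 ^ m * c \<le> 2 ^ n * c" if "m \<le> n" for m n :: nat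
      using that c by (simp add: power_increasing)
    then show ?thesis unfolding decseq_def E_def by (blast intro: order_trans)
  qed
  have "(\<lambda>n. prob (E n)) \<longlonglongrightarrow> prob (\<Inter>n. E n)"
    by (intro finite_Lim_measure_decseq dec) (auto simp: E_def)
  also have "(\<Inter>n. E n) = {}"
  proof -
    have "\<exists>n. \<not> 2 ^ n * c \<le> f x" for x
    proof -
      obtain n :: nat where "f x / c < 2 ^ n" using real_arch_pow[of 2 "f x / c"] by auto
      then show ?thesis using c by (auto simp: field_simps not_le)
    qed
    then show ?thesis by (auto simp: E_def)
  qed
  finally have "eventually (\<lambda>n. prob (E n) < 1/4) sequentially"
    by (rule order_tendstoD) simp
  then have ex: "\<exists>n. prob (E n) < 1/4" by (auto simp: eventually_sequentially)
  define n where "n = (LEAST n. prob (E n) < 1/4)"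
  have n: "prob (E n) < 1/4" unfolding n_def using ex by (rule LeastI_ex)
  have "n \<noteq> 0"
  proof
    assume "n = 0" then show False using n n0 by (simp add: E_def c_def)
  qed
  then obtain m where m: "n = Suc m" by (auto simp: gr0_conv_Suc)
  have "\<not> prob (E m) < 1/4" using not_less_Least[of m "\<lambda>n. prob (E n) < 1/4"] m n_def by auto
  moreover have "prob {x\<in>space M. 2 * (2 ^ m * c) < f x} \<le> prob (E n)"
    by (intro finite_measure_mono) (auto simp: E_def m)
  ultimately show thesis
    using that[of "2 ^ m * c"] n c by (auto simp: E_def)
qed

text \<open>The infimum of \<open>\<integral>\<^sub>A k(y, x)\<close> over all sets \<open>A\<close> of mass \<open>1/4\<close> is positive, but its measurability in \<open>y\<close>
is unclear. The explicit bound used instead: if \<open>k(y, \<cdot>)\<close> is below \<open>c\<close> with probability at most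
\<open>1/8\<close>, then it exceeds \<open>c\<close> on a part of \<open>A\<close> of mass at least \<open>1/8\<close>, so the integral is at least \<open>c/8\<close>.\<close>

lemma kernel_lower_weight:
  fixes k :: "'b \<times> 'a \<Rightarrow> real"
  assumes "prob_space M" and [measurable]: "k \<in> borel_measurable (N \<Otimes>\<^sub>M M)" and pos: "\<And>z. 0 < k z"
  obtains \<beta> where "\<beta> \<in> borel_measurable N" "\<And>y. 0 < \<beta> y" "\<And>y. \<beta> y \<le> 1"
    "\<And>y A. y \<in> space N \<Longrightarrow> A \<in> sets M \<Longrightarrow> 1/4 \<le> measure M A \<Longrightarrow>
       ennreal (\<beta> y) \<le> (\<integral>\<^sup>+x. indicator A x * ennreal (k (y, x)) \<partial>M)"
proof -
  interpret M: prob_space M by fact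
  define B where "B y n = {x\<in>space M. k (y, x) < inverse (real (Suc n))}" for y n
  define \<beta> where "\<beta> y = inverse (8 * real (Suc (LEAST n. emeasure M (B y n) \<le> ennreal (1/8))))" for y
  have [measurable]: "(\<lambda>y. emeasure M (B y n)) \<in> borel_measurable N" for n
  proof -
    have "(\<lambda>y. emeasure M (B y n)) \<in> borel_measurable N
        \<longleftrightarrow> (\<lambda>y. emeasure M (Pair y -` {z\<in>space (N \<Otimes>\<^sub>M M). k z < inverse (real (Suc n))})) \<in> borel_measurable N"
      by (intro measurable_cong arg_cong[where f="emeasure M"]) (auto simp: B_def space_pair_measure)
    also have "\<dots>" by (rule M.measurable_emeasure_Pair) measurable
    finally show ?thesis .
  qed
  have meas: "\<beta> \<in> borel_measurable N" unfolding \<beta>_def by measurable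
  have sets_B[measurable]: "B y n \<in> sets M" if "y \<in> space N" for y n
    using that unfolding B_def by measurable
  have ex: "\<exists>n. emeasure M (B y n) \<le> ennreal (1/8)" if y: "y \<in> space N" for y
  proof -
    have [measurable]: "(\<lambda>x. k (y, x)) \<in> borel_measurable M" using y by measurable
    obtain n :: nat where "M.prob (B y n) < 1/8"
      using M.positive_bounded_below[of "\<lambda>x. k (y, x)" "1/8"] pos by (auto simp: B_def)
    then show ?thesis by (intro exI[of _ n]) (simp add: M.emeasure_eq_measure)
  qed
  have low: "ennreal (\<beta> y) \<le> (\<integral>\<^sup>+x. indicator A x * ennreal (k (y, x)) \<partial>M)"
    if y: "y \<in> space N" and [measurable]: "A \<in> sets M" and A: "1/4 \<le> measure M A" for y A
  proof -
    define n where "n = (LEAST n. emeasure M (B y n) \<le> ennreal (1/8))"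
    have "emeasure M (B y n) \<le> ennreal (1/8)" unfolding n_def using ex[OF y] by (rule LeastI_ex)
    then have Bn: "M.prob (B y n) \<le> 1/8" by (simp add: M.emeasure_eq_measure)
    note sets_B[OF y, of n, measurable]
    have "M.prob A \<le> M.prob ((A - B y n) \<union> B y n)" by (intro M.finite_measure_mono) auto
    also have "\<dots> \<le> M.prob (A - B y n) + M.prob (B y n)" by (intro measure_Un_le) auto
    finally have "1/8 \<le> M.prob (A - B y n)" using A Bn by simp
    then have "inverse (real (Suc n)) * (1/8) \<le> inverse (real (Suc n)) * M.prob (A - B y n)"
      by (intro mult_left_mono) auto
    then have "\<beta> y \<le> inverse (real (Suc n)) * M.prob (A - B y n)"
      by (simp only: \<beta>_def n_def[symmetric]) (simp only: inverse_mult_distrib mult.commute, simp)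
    then have "ennreal (\<beta> y) \<le> (\<integral>\<^sup>+x. ennreal (inverse (real (Suc n))) * indicator (A - B y n) x \<partial>M)"
      by (subst nn_integral_cmult_indicator)
        (auto simp: M.emeasure_eq_measure ennreal_mult''[symmetric] ennreal_leI)
    also have "\<dots> \<le> (\<integral>\<^sup>+x. indicator A x * ennreal (k (y, x)) \<partial>M)"
      by (intro nn_integral_mono) (auto simp: B_def not_less indicator_def ennreal_leI)
    finally show ?thesis .
  qed
  show thesis
    by (rule that[OF meas _ _ low]) (auto simp: \<beta>_def divide_simps)
qed

text \<open>Integrating \<open>1 + \<tau>\<close> and \<open>1 - \<tau>\<close>, both nonnegative, against the smaller image measure and against \<open>M\<close>
yields the two inequalities.\<close>

lemma submarginal_test_function:
  fixes \<tau> :: "'a \<Rightarrow> real" and X :: "'c \<Rightarrow> 'a"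
  assumes M: "prob_space M" and Q: "finite_measure Q" and [measurable]: "X \<in> Q \<rightarrow>\<^sub>M M"
    and sub: "\<And>s. s \<in> borel_measurable M \<Longrightarrow> (\<integral>\<^sup>+z. s (X z) \<partial>Q) \<le> (\<integral>\<^sup>+x. s x \<partial>M)"
    and [measurable]: "\<tau> \<in> borel_measurable M" and bdd: "\<And>x. \<bar>\<tau> x\<bar> \<le> 1"
  shows "\<bar>(\<integral>z. \<tau> (X z) \<partial>Q) - (\<integral>x. \<tau> x \<partial>M)\<bar> \<le> 1 - measure Q (space Q)"
proof -
  interpret M: prob_space M by fact
  interpret Q: finite_measure Q by fact
  have intM: "integrable M \<tau>"
    by (intro M.integrable_const_bound[of _ 1] AE_I2) (auto simp: bdd)
  have intQ: "integrable Q (\<lambda>z. \<tau> (X z))"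
    by (intro Q.integrable_const_bound[of _ 1] AE_I2) (auto simp: bdd)
  have le: "measure Q (space Q) + c * (\<integral>z. \<tau> (X z) \<partial>Q) \<le> 1 + c * (\<integral>x. \<tau> x \<partial>M)"
    if c: "c = 1 \<or> c = -1" for c :: real
  proof -
    have pos: "0 \<le> 1 + c * \<tau> x" for x using bdd[of x] c by auto
    have "ennreal (\<integral>z. 1 + c * \<tau> (X z) \<partial>Q) = (\<integral>\<^sup>+z. ennreal (1 + c * \<tau> (X z)) \<partial>Q)"
      using intQ pos by (subst nn_integral_eq_integral) auto
    also have "\<dots> \<le> (\<integral>\<^sup>+x. ennreal (1 + c * \<tau> x) \<partial>M)"
      by (rule sub) measurable
    also have "\<dots> = ennreal (\<integral>x. 1 + c * \<tau> x \<partial>M)"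
      using intM pos by (subst nn_integral_eq_integral) auto
    finally have "(\<integral>z. 1 + c * \<tau> (X z) \<partial>Q) \<le> (\<integral>x. 1 + c * \<tau> x \<partial>M)"
      using pos by (subst (asm) ennreal_le_iff) (auto intro!: integral_nonneg_AE)
    then show ?thesis using intM intQ M.prob_space by (simp add: )
  qed
  from le[of 1] le[of "-1"] show ?thesis by (simp add: abs_le_iff)
qed

section \<open>Comparing two scalings of a kernel\<close>

text \<open>The density \<open>p\<close> describes a measure whose marginals are dominated by \<open>M\<close> and \<open>N\<close>. Domination is
stated through integrals of test functions, so that no exceptional null sets of sections have to be
tracked.\<close>

definition submarginals :: "'a measure \<Rightarrow> 'b measure \<Rightarrow> ('a \<times> 'b \<Rightarrow> real) \<Rightarrow> bool" where
  "submarginals M N p \<longleftrightarrow> p \<in> borel_measurable (M \<Otimes>\<^sub>M N) \<and> (\<forall>z. 0 \<le> p z) \<and>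
     (\<forall>s\<in>borel_measurable M. (\<integral>\<^sup>+z. s (fst z) * ennreal (p z) \<partial>(M \<Otimes>\<^sub>M N)) \<le> (\<integral>\<^sup>+x. s x \<partial>M)) \<and>
     (\<forall>s\<in>borel_measurable N. (\<integral>\<^sup>+z. s (snd z) * ennreal (p z) \<partial>(M \<Otimes>\<^sub>M N)) \<le> (\<integral>\<^sup>+y. s y \<partial>N))"

context pair_prob_space
begin

lemma submarginals_integrable:
  assumes "submarginals M1 M2 p"
  shows "integrable (M1 \<Otimes>\<^sub>M M2) p" and "(\<integral>z. p z \<partial>(M1 \<Otimes>\<^sub>M M2)) \<le> 1"
    and "(\<integral>\<^sup>+z. ennreal (p z) \<partial>(M1 \<Otimes>\<^sub>M M2)) = ennreal (\<integral>z. p z \<partial>(M1 \<Otimes>\<^sub>M M2))"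
proof -
  have [measurable]: "p \<in> borel_measurable (M1 \<Otimes>\<^sub>M M2)" and p: "\<And>z. 0 \<le> p z"
    and "(\<integral>\<^sup>+z. 1 * ennreal (p z) \<partial>(M1 \<Otimes>\<^sub>M M2)) \<le> (\<integral>\<^sup>+x. 1 \<partial>M1)"
    using assms unfolding submarginals_def by (auto elim!: ballE[of _ _ "\<lambda>_. 1"])
  then have le: "(\<integral>\<^sup>+z. ennreal (p z) \<partial>(M1 \<Otimes>\<^sub>M M2)) \<le> 1" by (simp add: M1.emeasure_space_1)
  then show int: "integrable (M1 \<Otimes>\<^sub>M M2) p"
    using p by (intro integrableI_bounded) (auto intro: le_less_trans)
  show eq: "(\<integral>\<^sup>+z. ennreal (p z) \<partial>(M1 \<Otimes>\<^sub>M M2)) = ennreal (\<integral>z. p z \<partial>(M1 \<Otimes>\<^sub>M M2))"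
    using int p by (intro nn_integral_eq_integral) auto
  show "(\<integral>z. p z \<partial>(M1 \<Otimes>\<^sub>M M2)) \<le> 1"
    using le unfolding eq by simp
qed

text \<open>The previous estimate for the measure with density \<open>p\<close> and its two projections.\<close>

lemma submarginals_test:
  fixes \<tau> :: "'a \<Rightarrow> real" and \<sigma> :: "'b \<Rightarrow> real"
  assumes p: "submarginals M1 M2 p"
  shows "\<tau> \<in> borel_measurable M1 \<Longrightarrow> (\<And>x. \<bar>\<tau> x\<bar> \<le> 1) \<Longrightarrow>
     \<bar>(\<integral>z. \<tau> (fst z) * p z \<partial>(M1 \<Otimes>\<^sub>M M2)) - (\<integral>x. \<tau> x \<partial>M1)\<bar> \<le> 1 - (\<integral>z. p z \<partial>(M1 \<Otimes>\<^sub>M M2))"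
    and "\<sigma> \<in> borel_measurable M2 \<Longrightarrow> (\<And>y. \<bar>\<sigma> y\<bar> \<le> 1) \<Longrightarrow>
     \<bar>(\<integral>z. \<sigma> (snd z) * p z \<partial>(M1 \<Otimes>\<^sub>M M2)) - (\<integral>y. \<sigma> y \<partial>M2)\<bar> \<le> 1 - (\<integral>z. p z \<partial>(M1 \<Otimes>\<^sub>M M2))"
proof -
  let ?P = "M1 \<Otimes>\<^sub>M M2"
  define Q where "Q = density ?P (\<lambda>z. ennreal (p z))"
  have p_meas[measurable]: "p \<in> borel_measurable ?P" and p_nonneg: "\<And>z. 0 \<le> p z"
    and sub1: "\<And>s. s \<in> borel_measurable M1 \<Longrightarrow> (\<integral>\<^sup>+z. s (fst z) * ennreal (p z) \<partial>?P) \<le> (\<integral>\<^sup>+x. s x \<partial>M1)"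
    and sub2: "\<And>s. s \<in> borel_measurable M2 \<Longrightarrow> (\<integral>\<^sup>+z. s (snd z) * ennreal (p z) \<partial>?P) \<le> (\<integral>\<^sup>+y. s y \<partial>M2)"
    using p by (auto simp: submarginals_def)
  have mass: "emeasure Q (space Q) = ennreal (\<integral>z. p z \<partial>?P)"
    using submarginals_integrable(3)[OF p]
    by (simp add: Q_def emeasure_density indicator_def mult.commute cong: nn_integral_cong)
  have Q: "finite_measure Q"
    by (rule finite_measureI) (simp add: mass)
  have meas: "measure Q (space Q) = (\<integral>z. p z \<partial>?P)"
    using mass p_nonneg by (simp add: measure_def integral_nonneg_AE)
  have sets_Q[measurable_cong]: "sets Q = sets ?P" by (simp add: Q_def)
  {
    assume \<tau>[measurable]: "\<tau> \<in> borel_measurable M1" and bdd: "\<And>x. \<bar>\<tau> x\<bar> \<le> 1"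
    have "\<bar>(\<integral>z. \<tau> (fst z) \<partial>Q) - (\<integral>x. \<tau> x \<partial>M1)\<bar> \<le> 1 - measure Q (space Q)"
    proof (rule submarginal_test_function[OF M1.prob_space_axioms Q])
      show "(\<integral>\<^sup>+z. s (fst z) \<partial>Q) \<le> (\<integral>\<^sup>+x. s x \<partial>M1)" if [measurable]: "s \<in> borel_measurable M1" for s
        unfolding Q_def using sub1[OF that] by (simp add: nn_integral_density mult.commute)
    qed (use bdd in auto)
    also have "(\<integral>z. \<tau> (fst z) \<partial>Q) = (\<integral>z. \<tau> (fst z) * p z \<partial>?P)"
      unfolding Q_def using p_nonneg by (subst integral_density) (auto simp: mult.commute)
    finally show "\<bar>(\<integral>z. \<tau> (fst z) * p z \<partial>?P) - (\<integral>x. \<tau> x \<partial>M1)\<bar> \<le> 1 - (\<integral>z. p z \<partial>?P)"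
      by (simp add: meas)
  }
  {
    assume \<sigma>[measurable]: "\<sigma> \<in> borel_measurable M2" and bdd: "\<And>x. \<bar>\<sigma> x\<bar> \<le> 1"
    have "\<bar>(\<integral>z. \<sigma> (snd z) \<partial>Q) - (\<integral>x. \<sigma> x \<partial>M2)\<bar> \<le> 1 - measure Q (space Q)"
    proof (rule submarginal_test_function[OF M2.prob_space_axioms Q])
      show "(\<integral>\<^sup>+z. s (snd z) \<partial>Q) \<le> (\<integral>\<^sup>+x. s x \<partial>M2)" if [measurable]: "s \<in> borel_measurable M2" for s
        unfolding Q_def using sub2[OF that] by (simp add: nn_integral_density mult.commute)
    qed (use bdd in auto)
    also have "(\<integral>z. \<sigma> (snd z) \<partial>Q) = (\<integral>z. \<sigma> (snd z) * p z \<partial>?P)"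
      unfolding Q_def using p_nonneg by (subst integral_density) (auto simp: mult.commute)
    finally show "\<bar>(\<integral>z. \<sigma> (snd z) * p z \<partial>?P) - (\<integral>x. \<sigma> x \<partial>M2)\<bar> \<le> 1 - (\<integral>z. p z \<partial>?P)"
      by (simp add: meas)
  }
qed

end

text \<open>This identity drives both uniqueness and convergence. The left factor is a sum of bounded functions
of \<open>a/b\<close> and \<open>c/d\<close> alone, while the right-hand side is nonnegative and vanishes only when the
products agree. The function \<open>r \<mapsto> (r - 1)/(r + 1)\<close> is increasing and changes sign under \<open>r \<mapsto> 1/r\<close>,
which makes the sum change sign exactly at \<open>(a/b)(c/d) = 1\<close>.\<close>

lemma difference_ratio_identity:
  fixes a b c d :: real
  assumes "0 < a" "0 < b" "0 < c" "0 < d"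
  shows "((a - b) / (a + b) + (c - d) / (c + d)) * (a * c - b * d)
       = 2 * (a * c - b * d)\<^sup>2 / ((a + b) * (c + d))"
proof -
  have "(a - b) / (a + b) + (c - d) / (c + d) = 2 * (a * c - b * d) / ((a + b) * (c + d))"
    using assms by (simp add: add_frac_eq) (simp add: algebra_simps)
  then show ?thesis by (simp add: power2_eq_square)
qed

locale scaling_kernel = pair_prob_space M1 M2
  for M1 :: "'a measure" and M2 :: "'b measure" +
  fixes h :: "'a \<times> 'b \<Rightarrow> real"
  assumes h_measurable[measurable]: "h \<in> borel_measurable (M1 \<Otimes>\<^sub>M M2)"
    and h_pos: "\<And>z. 0 < h z"
    and h_mass: "(\<integral>\<^sup>+z. ennreal (h z) \<partial>(M1 \<Otimes>\<^sub>M M2)) = 1"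
begin

definition scaled :: "('a \<Rightarrow> real) \<Rightarrow> ('b \<Rightarrow> real) \<Rightarrow> 'a \<times> 'b \<Rightarrow> real" where
  "scaled f g z = f (fst z) * g (snd z) * h z"

lemma scaled_measurable[measurable]:
  assumes [measurable]: "f \<in> borel_measurable M1" "g \<in> borel_measurable M2"
  shows "scaled f g \<in> borel_measurable (M1 \<Otimes>\<^sub>M M2)"
  unfolding scaled_def[abs_def] by measurable

text \<open>Apply the preceding identity pointwise with \<open>a, b = f, f'\<close> and \<open>c, d = g, g'\<close> and integrate against
the kernel. Since \<open>\<tau>(x) + \<sigma>(y)\<close> splits into bounded functions of one coordinate, the integral of the
left-hand side depends only on the marginals of the two scaled kernels, and these differ from \<open>M1\<close>
and \<open>M2\<close> by at most the missing masses.\<close>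

lemma scaled_difference_bound:
  assumes sub: "submarginals M1 M2 (scaled f g)" "submarginals M1 M2 (scaled f' g')"
    and [measurable]: "f \<in> borel_measurable M1" "f' \<in> borel_measurable M1"
      "g \<in> borel_measurable M2" "g' \<in> borel_measurable M2"
    and pos: "\<And>x. 0 < f x" "\<And>x. 0 < f' x" "\<And>y. 0 < g y" "\<And>y. 0 < g' y"
  defines "E \<equiv> \<lambda>z. h z * (f (fst z) * g (snd z) - f' (fst z) * g' (snd z))\<^sup>2
      / ((f (fst z) + f' (fst z)) * (g (snd z) + g' (snd z)))"
  shows "integrable (M1 \<Otimes>\<^sub>M M2) E"
    and "(\<integral>z. E z \<partial>(M1 \<Otimes>\<^sub>M M2))
       \<le> 2 - (\<integral>z. scaled f g z \<partial>(M1 \<Otimes>\<^sub>M M2)) - (\<integral>z. scaled f' g' z \<partial>(M1 \<Otimes>\<^sub>M M2))"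
proof -
  let ?P = "M1 \<Otimes>\<^sub>M M2"
  define \<tau> where "\<tau> x = (f x - f' x) / (f x + f' x)" for x
  define \<sigma> where "\<sigma> y = (g y - g' y) / (g y + g' y)" for y
  have [measurable]: "\<tau> \<in> borel_measurable M1" "\<sigma> \<in> borel_measurable M2"
    unfolding \<tau>_def \<sigma>_def by measurable
  have \<tau>: "\<bar>\<tau> x\<bar> \<le> 1" for x using pos(1,2)[of x] by (auto simp: \<tau>_def field_simps)
  have \<sigma>: "\<bar>\<sigma> y\<bar> \<le> 1" for y using pos(3,4)[of y] by (auto simp: \<sigma>_def field_simps)
  let ?p = "scaled f g" and ?p' = "scaled f' g'"
  have int: "integrable ?P (\<lambda>z. \<tau> (fst z) * p z)" "integrable ?P (\<lambda>z. \<sigma> (snd z) * p z)"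
    if "integrable ?P p" for p
  proof -
    have [measurable]: "p \<in> borel_measurable ?P" using that by simp
    have "\<bar>\<tau> (fst z) * p z\<bar> \<le> \<bar>p z\<bar>" "\<bar>\<sigma> (snd z) * p z\<bar> \<le> \<bar>p z\<bar>" for z
      using \<tau> \<sigma> by (auto simp: abs_mult intro: mult_left_le_one_le)
    then show "integrable ?P (\<lambda>z. \<tau> (fst z) * p z)" "integrable ?P (\<lambda>z. \<sigma> (snd z) * p z)"
      by (auto intro!: Bochner_Integration.integrable_bound[OF that])
  qed
  note ip = int[OF submarginals_integrable(1)[OF sub(1)]]
  note ip' = int[OF submarginals_integrable(1)[OF sub(2)]]
  have E: "2 * E z = (\<tau> (fst z) * ?p z - \<tau> (fst z) * ?p' z) + (\<sigma> (snd z) * ?p z - \<sigma> (snd z) * ?p' z)" for z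
  proof -
    obtain x y where z: "z = (x, y)" by (cases z)
    have "2 * E z = h z * (2 * (f x * g y - f' x * g' y)\<^sup>2 / ((f x + f' x) * (g y + g' y)))"
      by (simp add: E_def z)
    also have "\<dots> = h z * ((\<tau> x + \<sigma> y) * (f x * g y - f' x * g' y))"
      unfolding \<tau>_def \<sigma>_def by (subst difference_ratio_identity[OF pos(1,2,3,4)]) simp
    also have "\<dots> = (\<tau> x * ?p z - \<tau> x * ?p' z) + (\<sigma> y * ?p z - \<sigma> y * ?p' z)"
      by (simp add: scaled_def z algebra_simps)
    finally show ?thesis by (simp add: z)
  qed
  have "integrable ?P (\<lambda>z. 2 * E z)"
    unfolding E using ip ip' by auto
  then show "integrable ?P E" by simp
  have "2 * (\<integral>z. E z \<partial>?P) = (\<integral>z. 2 * E z \<partial>?P)" by simp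
  also have "\<dots> = ((\<integral>z. \<tau> (fst z) * ?p z \<partial>?P) - (\<integral>z. \<tau> (fst z) * ?p' z \<partial>?P))
      + ((\<integral>z. \<sigma> (snd z) * ?p z \<partial>?P) - (\<integral>z. \<sigma> (snd z) * ?p' z \<partial>?P))"
    unfolding E using ip ip' by simp
  also have "\<dots> \<le> 2 * (2 - (\<integral>z. ?p z \<partial>?P) - (\<integral>z. ?p' z \<partial>?P))"
    using submarginals_test(1)[OF sub(1), of \<tau>] submarginals_test(1)[OF sub(2), of \<tau>]
      submarginals_test(2)[OF sub(1), of \<sigma>] submarginals_test(2)[OF sub(2), of \<sigma>] \<tau> \<sigma>
    by simp
  finally show "(\<integral>z. E z \<partial>?P) \<le> 2 - (\<integral>z. ?p z \<partial>?P) - (\<integral>z. ?p' z \<partial>?P)" by simp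
qed

end

section \<open>The regularised scaling equations\<close>

context scaling_kernel
begin

text \<open>The inequalities hold at every point and not just almost everywhere, so that they bound \<open>f\<close> and \<open>g\<close>
themselves.\<close>

definition subscaling :: "('a \<Rightarrow> real) \<Rightarrow> ('b \<Rightarrow> real) \<Rightarrow> bool" where
  "subscaling f g \<longleftrightarrow> f \<in> borel_measurable M1 \<and> g \<in> borel_measurable M2 \<and>
     (\<forall>x. 0 < f x) \<and> (\<forall>y. 0 < g y) \<and>
     (\<forall>x\<in>space M1. (\<integral>\<^sup>+y. ennreal (scaled f g (x, y)) \<partial>M2) \<le> 1) \<and>
     (\<forall>y\<in>space M2. (\<integral>\<^sup>+x. ennreal (scaled f g (x, y)) \<partial>M1) \<le> 1)"

text \<open>The equations read \<open>f (e + \<integral> h g) = 1\<close> and \<open>g (e + \<integral> h f) = 1\<close>. For \<open>e = 0\<close> they are the scaling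
equations; a positive \<open>e\<close> keeps \<open>f\<close> and \<open>g\<close> below \<open>1/e\<close> and removes the freedom to move a constant
from \<open>f\<close> to \<open>g\<close>.\<close>

definition regularised :: "real \<Rightarrow> ('a \<Rightarrow> real) \<Rightarrow> ('b \<Rightarrow> real) \<Rightarrow> bool" where
  "regularised e f g \<longleftrightarrow> f \<in> borel_measurable M1 \<and> g \<in> borel_measurable M2 \<and>
     (\<forall>x. 0 < f x) \<and> (\<forall>y. 0 < g y) \<and>
     (\<forall>x\<in>space M1. ennreal (e * f x) + (\<integral>\<^sup>+y. ennreal (scaled f g (x, y)) \<partial>M2) = 1) \<and>
     (\<forall>y\<in>space M2. ennreal (e * g y) + (\<integral>\<^sup>+x. ennreal (scaled f g (x, y)) \<partial>M1) = 1)"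

abbreviation mass :: "('a \<Rightarrow> real) \<Rightarrow> ('b \<Rightarrow> real) \<Rightarrow> real" where
  "mass f g \<equiv> (\<integral>z. scaled f g z \<partial>(M1 \<Otimes>\<^sub>M M2))"

lemma regularised_imp_subscaling: "regularised e f g \<Longrightarrow> subscaling f g"
  unfolding regularised_def subscaling_def by (metis add_increasing zero_le order_refl)

lemma subscaling_imp_submarginals:
  assumes "subscaling f g"
  shows "submarginals M1 M2 (scaled f g)"
  unfolding submarginals_def
proof (intro conjI ballI allI)
  have [measurable]: "f \<in> borel_measurable M1" "g \<in> borel_measurable M2"
    and pos: "\<And>x. 0 < f x" "\<And>y. 0 < g y"
    and sub1: "\<And>x. x \<in> space M1 \<Longrightarrow> (\<integral>\<^sup>+y. ennreal (scaled f g (x, y)) \<partial>M2) \<le> 1"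
    and sub2: "\<And>y. y \<in> space M2 \<Longrightarrow> (\<integral>\<^sup>+x. ennreal (scaled f g (x, y)) \<partial>M1) \<le> 1"
    using assms by (auto simp: subscaling_def)
  show "scaled f g \<in> borel_measurable (M1 \<Otimes>\<^sub>M M2)" by measurable
  show "0 \<le> scaled f g z" for z
    using pos h_pos by (simp add: scaled_def less_imp_le)
  show "(\<integral>\<^sup>+z. s (fst z) * ennreal (scaled f g z) \<partial>(M1 \<Otimes>\<^sub>M M2)) \<le> (\<integral>\<^sup>+x. s x \<partial>M1)"
    if [measurable]: "s \<in> borel_measurable M1" for s
  proof -
    have "(\<integral>\<^sup>+z. s (fst z) * ennreal (scaled f g z) \<partial>(M1 \<Otimes>\<^sub>M M2))
        = (\<integral>\<^sup>+x. \<integral>\<^sup>+y. s x * ennreal (scaled f g (x, y)) \<partial>M2 \<partial>M1)"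
      by (subst M2.nn_integral_fst[symmetric]) auto
    also have "\<dots> = (\<integral>\<^sup>+x. s x * (\<integral>\<^sup>+y. ennreal (scaled f g (x, y)) \<partial>M2) \<partial>M1)"
      by (intro nn_integral_cong nn_integral_cmult) measurable
    also have "\<dots> \<le> (\<integral>\<^sup>+x. s x * 1 \<partial>M1)"
      by (intro nn_integral_mono mult_left_mono sub1) auto
    finally show ?thesis by simp
  qed
  show "(\<integral>\<^sup>+z. s (snd z) * ennreal (scaled f g z) \<partial>(M1 \<Otimes>\<^sub>M M2)) \<le> (\<integral>\<^sup>+y. s y \<partial>M2)"
    if [measurable]: "s \<in> borel_measurable M2" for s
  proof -
    have "(\<integral>\<^sup>+z. s (snd z) * ennreal (scaled f g z) \<partial>(M1 \<Otimes>\<^sub>M M2))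
        = (\<integral>\<^sup>+y. \<integral>\<^sup>+x. s y * ennreal (scaled f g (x, y)) \<partial>M1 \<partial>M2)"
      by (subst nn_integral_snd[symmetric]) auto
    also have "\<dots> = (\<integral>\<^sup>+y. s y * (\<integral>\<^sup>+x. ennreal (scaled f g (x, y)) \<partial>M1) \<partial>M2)"
      by (intro nn_integral_cong nn_integral_cmult) measurable
    also have "\<dots> \<le> (\<integral>\<^sup>+y. s y * 1 \<partial>M2)"
      by (intro nn_integral_mono mult_left_mono sub2) auto
    finally show ?thesis by simp
  qed
qed

text \<open>Solving the first equation for \<open>f\<close> and solving the second for \<open>g\<close> are both antitone operations, so their composition is monotone and bounded by \<open>1/e\<close>. Iterating it from \<open>0\<close>
produces an increasing sequence, and dominated convergence, based on the bound \<open>1/e\<close> and the finite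
sections of \<open>h\<close>, shows that its limit is a fixed point.\<close>

lemma regularised_exists:
  assumes fin1: "\<And>x. x \<in> space M1 \<Longrightarrow> (\<integral>\<^sup>+y. ennreal (h (x, y)) \<partial>M2) < \<infinity>"
    and fin2: "\<And>y. y \<in> space M2 \<Longrightarrow> (\<integral>\<^sup>+x. ennreal (h (x, y)) \<partial>M1) < \<infinity>"
    and e: "0 < e"
  obtains f g where "regularised e f g"
proof -
  define A where "A u x = inverse (ennreal e + (\<integral>\<^sup>+y. u y * ennreal (h (x, y)) \<partial>M2))"
    for u :: "'b \<Rightarrow> ennreal" and x
  define B where "B v y = inverse (ennreal e + (\<integral>\<^sup>+x. v x * ennreal (h (x, y)) \<partial>M1))"
    for v :: "'a \<Rightarrow> ennreal" and y
  have A_meas[measurable]: "A u \<in> borel_measurable M1" if [measurable]: "u \<in> borel_measurable M2" for u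
    unfolding A_def[abs_def] by measurable
  have B_meas[measurable]: "B v \<in> borel_measurable M2" if [measurable]: "v \<in> borel_measurable M1" for v
    unfolding B_def[abs_def] by measurable
  have inv_anti: "inverse b \<le> inverse a" if le: "a \<le> b" for a b :: ennreal
  proof (cases "a = 0 \<or> b = top")
    case False
    then obtain s where s: "b = ennreal s" "0 \<le> s" by (cases b) auto
    then obtain r where r: "a = ennreal r" "0 \<le> r" using le by (cases a) (auto simp: top_unique)
    with r have "0 < r" "r \<le> s" using False le s by (auto simp: less_le)
    then show ?thesis using r s by (simp add: inverse_ennreal le_imp_inverse_le)
  qed auto
  have A_anti: "A u' x \<le> A u x" if "\<And>y. u y \<le> u' y" for u u' x
    unfolding A_def by (intro inv_anti add_left_mono nn_integral_mono mult_right_mono that) auto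
  have B_anti: "B v' y \<le> B v y" if "\<And>x. v x \<le> v' x" for v v' y
    unfolding B_def by (intro inv_anti add_left_mono nn_integral_mono mult_right_mono that) auto
  have A_le: "A u x \<le> ennreal (inverse e)" and B_le: "B v y \<le> ennreal (inverse e)" for u x v y
    unfolding A_def B_def by (simp_all add: inverse_ennreal[OF e, symmetric] inv_anti)
  have inv_lim: "(\<lambda>n. inverse (ennreal e + u n)) \<longlonglongrightarrow> inverse (ennreal e + l)"
    if "u \<longlonglongrightarrow> l" for u :: "nat \<Rightarrow> ennreal" and l
  proof -
    have "continuous_on UNIV (\<lambda>r. inverse (ennreal e + r))"
      by (intro continuous_intros continuous_on_add_ennreal)
    then show ?thesis
      using that by (rule continuous_on_tendsto_compose) auto
  qed
  define G where "G n = ((\<lambda>u. B (A u)) ^^ n) (\<lambda>_. 0)" for n :: nat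
  have G_Suc: "G (Suc n) = B (A (G n))" for n by (simp add: G_def)
  have G_meas[measurable]: "G n \<in> borel_measurable M2" for n
    by (induction n) (simp_all add: G_Suc, simp add: G_def)
  \<comment> \<open>Two antitone steps make a monotone one.\<close>
  have G_step: "G n y \<le> G (Suc n) y" for n y
  proof (induction n arbitrary: y)
    case 0 show ?case by (simp add: G_def)
  next
    case (Suc n) then show ?case
      unfolding G_Suc[of n] G_Suc[of "Suc n"] by (intro B_anti A_anti)
  qed
  then have G_inc: "incseq G" by (intro incseq_SucI le_funI)
  define g where "g y = (SUP n. G n y)" for y
  have [measurable]: "g \<in> borel_measurable M2" unfolding g_def[abs_def] by measurable
  have G_lim: "(\<lambda>n. G n y) \<longlonglongrightarrow> g y" for y
    unfolding g_def using G_inc by (intro LIMSEQ_SUP) (auto simp: incseq_def le_fun_def)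
  have G_le: "G n y \<le> ennreal (inverse e)" for n y
    using B_le by (cases n) (auto simp: G_Suc, simp add: G_def)
  have A_lim: "(\<lambda>n. A (G n) x) \<longlonglongrightarrow> A g x" if x: "x \<in> space M1" for x
    unfolding A_def
  proof (intro inv_lim nn_integral_dominated_convergence[where w="\<lambda>y. ennreal (inverse e) * ennreal (h (x, y))"])
    note [measurable] = x
    show "(\<integral>\<^sup>+y. ennreal (inverse e) * ennreal (h (x, y)) \<partial>M2) < \<infinity>"
      using fin1[OF x] by (subst nn_integral_cmult) (auto simp: ennreal_mult_less_top)
    show "AE y in M2. (\<lambda>n. G n y * ennreal (h (x, y))) \<longlonglongrightarrow> g y * ennreal (h (x, y))"
      unfolding mult.commute[of _ "ennreal _"] using G_lim by (intro AE_I2 ennreal_tendsto_cmult) auto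
  qed (use x in \<open>auto intro!: mult_right_mono G_le\<close>)
  have B_lim: "(\<lambda>n. B (A (G n)) y) \<longlonglongrightarrow> B (A g) y" if y: "y \<in> space M2" for y
    unfolding B_def
  proof (intro inv_lim nn_integral_dominated_convergence[where w="\<lambda>x. ennreal (inverse e) * ennreal (h (x, y))"])
    show "(\<integral>\<^sup>+x. ennreal (inverse e) * ennreal (h (x, y)) \<partial>M1) < \<infinity>"
      using fin2[OF y] y by (subst nn_integral_cmult) (auto simp: ennreal_mult_less_top)
    show "AE x in M1. (\<lambda>n. A (G n) x * ennreal (h (x, y))) \<longlonglongrightarrow> A g x * ennreal (h (x, y))"
      unfolding mult.commute[of _ "ennreal _"] using A_lim by (intro AE_I2 ennreal_tendsto_cmult) auto
  qed (use y in \<open>auto intro!: mult_right_mono A_le\<close>)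
  have g_eq: "g y = B (A g) y" if "y \<in> space M2" for y
    using LIMSEQ_unique[OF LIMSEQ_Suc[OF G_lim[of y]]] B_lim[OF that] by (simp add: G_Suc)
  define f where "f = A g"
  have [measurable]: "f \<in> borel_measurable M1" unfolding f_def by measurable
  \<comment> \<open>The value \<open>1\<close> off the space makes the real-valued versions positive everywhere.\<close>
  define f' where "f' x = (if x \<in> space M1 then enn2real (f x) else 1)" for x
  define g' where "g' y = (if y \<in> space M2 then enn2real (g y) else 1)" for y
  have g_le: "g y \<le> ennreal (inverse e)" for y unfolding g_def by (intro SUP_least G_le)
  have f_le: "f x \<le> ennreal (inverse e)" for x unfolding f_def by (rule A_le)
  have f_fin: "f x < top" and g_fin: "g y < top" for x y
    using f_le[of x] g_le[of y] by (auto simp: le_less_trans)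
  have f': "ennreal (f' x) = f x" if "x \<in> space M1" for x using that f_fin[of x] by (simp add: f'_def)
  have g': "ennreal (g' y) = g y" if "y \<in> space M2" for y using that g_fin[of y] by (simp add: g'_def)
  have I1: "(\<integral>\<^sup>+y. g y * ennreal (h (x, y)) \<partial>M2) < top" if x: "x \<in> space M1" for x
  proof -
    have "(\<integral>\<^sup>+y. g y * ennreal (h (x, y)) \<partial>M2) \<le> (\<integral>\<^sup>+y. ennreal (inverse e) * ennreal (h (x, y)) \<partial>M2)"
      by (intro nn_integral_mono mult_right_mono g_le) auto
    also have "\<dots> < top" using fin1[OF x] x by (subst nn_integral_cmult) (auto simp: ennreal_mult_less_top)
    finally show ?thesis .
  qed
  have I2: "(\<integral>\<^sup>+x. f x * ennreal (h (x, y)) \<partial>M1) < top" if y: "y \<in> space M2" for y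
  proof -
    have "(\<integral>\<^sup>+x. f x * ennreal (h (x, y)) \<partial>M1) \<le> (\<integral>\<^sup>+x. ennreal (inverse e) * ennreal (h (x, y)) \<partial>M1)"
      by (intro nn_integral_mono mult_right_mono f_le) auto
    also have "\<dots> < top" using fin2[OF y] y by (subst nn_integral_cmult) (auto simp: ennreal_mult_less_top)
    finally show ?thesis .
  qed
  have cancel: "inverse a * a = 1" if "0 < a" "a < top" for a :: ennreal
    using ennreal_divide_self[of a] that by (simp add: divide_ennreal_def mult.commute)
  have f'_pos: "0 < f' x" for x
  proof (cases "x \<in> space M1")
    case True
    have "0 < f x" using I1[OF True] by (auto simp: f_def A_def ennreal_inverse_positive less_top[symmetric])
    then show ?thesis using f_fin[of x] True by (simp add: f'_def enn2real_positive_iff)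
  qed (simp add: f'_def)
  have g_B: "g y = inverse (ennreal e + (\<integral>\<^sup>+x. f x * ennreal (h (x, y)) \<partial>M1))" if "y \<in> space M2" for y
    using g_eq[OF that] by (simp add: B_def f_def)
  have g'_pos: "0 < g' y" for y
  proof (cases "y \<in> space M2")
    case True
    have "0 < g y" using I2[OF True] by (auto simp: g_B[OF True] ennreal_inverse_positive less_top[symmetric])
    then show ?thesis using g_fin[of y] True by (simp add: g'_def enn2real_positive_iff)
  qed (simp add: g'_def)
  have scaled_eq: "ennreal (scaled f' g' (x, y)) = f x * (g y * ennreal (h (x, y)))"
    if "x \<in> space M1" "y \<in> space M2" for x y
    using f'_pos[of x] g'_pos[of y] h_pos[of "(x, y)"]
    by (simp add: scaled_def ennreal_mult f'[OF that(1)] g'[OF that(2)] mult.assoc)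
  show thesis
  proof (rule that[of f' g'], unfold regularised_def, intro conjI ballI allI)
    show "f' \<in> borel_measurable M1"
      by (rule measurable_cong[THEN iffD2, of _ _ "\<lambda>x. enn2real (f x)"]) (auto simp: f'_def)
    show "g' \<in> borel_measurable M2"
      by (rule measurable_cong[THEN iffD2, of _ _ "\<lambda>x. enn2real (g x)"]) (auto simp: g'_def)
    show "ennreal (e * f' x) + (\<integral>\<^sup>+y. ennreal (scaled f' g' (x, y)) \<partial>M2) = 1" if x: "x \<in> space M1" for x
    proof -
      have "(\<integral>\<^sup>+y. ennreal (scaled f' g' (x, y)) \<partial>M2) = (\<integral>\<^sup>+y. f x * (g y * ennreal (h (x, y))) \<partial>M2)"
        by (intro nn_integral_cong scaled_eq x)
      also have "\<dots> = f x * (\<integral>\<^sup>+y. g y * ennreal (h (x, y)) \<partial>M2)"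
        using x by (intro nn_integral_cmult) measurable
      finally have "ennreal (e * f' x) + (\<integral>\<^sup>+y. ennreal (scaled f' g' (x, y)) \<partial>M2)
          = f x * (ennreal e + (\<integral>\<^sup>+y. g y * ennreal (h (x, y)) \<partial>M2))"
        using e f'_pos[of x] by (simp add: ennreal_mult f'[OF x] distrib_left mult.commute)
      also have "\<dots> = 1"
        unfolding f_def A_def using e I1[OF x] by (intro cancel) (auto simp: add_pos_nonneg)
      finally show ?thesis .
    qed
    show "ennreal (e * g' y) + (\<integral>\<^sup>+x. ennreal (scaled f' g' (x, y)) \<partial>M1) = 1" if y: "y \<in> space M2" for y
    proof -
      have "(\<integral>\<^sup>+x. ennreal (scaled f' g' (x, y)) \<partial>M1) = (\<integral>\<^sup>+x. g y * (f x * ennreal (h (x, y))) \<partial>M1)"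
        by (intro nn_integral_cong) (simp add: scaled_eq y mult_ac)
      also have "\<dots> = g y * (\<integral>\<^sup>+x. f x * ennreal (h (x, y)) \<partial>M1)"
        using y by (intro nn_integral_cmult) measurable
      finally have "ennreal (e * g' y) + (\<integral>\<^sup>+x. ennreal (scaled f' g' (x, y)) \<partial>M1)
          = g y * (ennreal e + (\<integral>\<^sup>+x. f x * ennreal (h (x, y)) \<partial>M1))"
        using e g'_pos[of y] by (simp add: ennreal_mult g'[OF y] distrib_left mult.commute)
      also have "\<dots> = 1"
        unfolding g_B[OF y] using e I2[OF y] by (intro cancel) (auto simp: add_pos_nonneg)
      finally show ?thesis .
    qed
  qed (use f'_pos g'_pos in auto)
qed

end

section \<open>Bounds uniform in the regularisation\<close>

context scaling_kernel
begin

text \<open>Integrating the two equations shows that the missing mass equals both \<open>\<integral> e f\<close> and \<open>\<integral> e g\<close>. As \<open>e f\<close>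
and \<open>e g\<close> are at most \<open>1\<close>, a deficit forces each of them to be large on a large set.\<close>

lemma regularised_mass_deficit:
  assumes reg: "regularised e f g" and e: "0 < e" and c: "0 < c" and def: "mass f g < 1 - c"
  shows "c / 2 \<le> M1.prob {x\<in>space M1. c / 2 \<le> e * f x}"
    and "c / 2 \<le> M2.prob {y\<in>space M2. c / 2 \<le> e * g y}"
proof -
  have [measurable]: "f \<in> borel_measurable M1" "g \<in> borel_measurable M2"
    and pos: "\<And>x. 0 < f x" "\<And>y. 0 < g y"
    and eq1: "\<And>x. x \<in> space M1 \<Longrightarrow> ennreal (e * f x) + (\<integral>\<^sup>+y. ennreal (scaled f g (x, y)) \<partial>M2) = 1"
    and eq2: "\<And>y. y \<in> space M2 \<Longrightarrow> ennreal (e * g y) + (\<integral>\<^sup>+x. ennreal (scaled f g (x, y)) \<partial>M1) = 1"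
    using reg by (auto simp: regularised_def)
  note sub = subscaling_imp_submarginals[OF regularised_imp_subscaling[OF reg]]
  note mass_eq = submarginals_integrable(3)[OF sub]
  have mass_nonneg: "0 \<le> mass f g"
    using sub by (auto simp: submarginals_def intro!: integral_nonneg_AE)
  have I1: "(\<integral>\<^sup>+x. ennreal (e * f x) \<partial>M1) + ennreal (mass f g) = 1"
  proof -
    have "(\<integral>\<^sup>+x. ennreal (e * f x) \<partial>M1) + ennreal (mass f g)
        = (\<integral>\<^sup>+x. ennreal (e * f x) \<partial>M1) + (\<integral>\<^sup>+x. \<integral>\<^sup>+y. ennreal (scaled f g (x, y)) \<partial>M2 \<partial>M1)"
      unfolding mass_eq[symmetric] by (subst M2.nn_integral_fst) auto
    also have "\<dots> = (\<integral>\<^sup>+x. ennreal (e * f x) + (\<integral>\<^sup>+y. ennreal (scaled f g (x, y)) \<partial>M2) \<partial>M1)"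
      by (intro nn_integral_add[symmetric]) measurable
    also have "\<dots> = (\<integral>\<^sup>+x. 1 \<partial>M1)" by (intro nn_integral_cong eq1)
    finally show ?thesis by (simp add: M1.emeasure_space_1)
  qed
  have I2: "(\<integral>\<^sup>+y. ennreal (e * g y) \<partial>M2) + ennreal (mass f g) = 1"
  proof -
    have "(\<integral>\<^sup>+y. ennreal (e * g y) \<partial>M2) + ennreal (mass f g)
        = (\<integral>\<^sup>+y. ennreal (e * g y) \<partial>M2) + (\<integral>\<^sup>+y. \<integral>\<^sup>+x. ennreal (scaled f g (x, y)) \<partial>M1 \<partial>M2)"
      unfolding mass_eq[symmetric] by (subst nn_integral_snd) auto
    also have "\<dots> = (\<integral>\<^sup>+y. ennreal (e * g y) + (\<integral>\<^sup>+x. ennreal (scaled f g (x, y)) \<partial>M1) \<partial>M2)"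
      by (intro nn_integral_add[symmetric]) measurable
    also have "\<dots> = (\<integral>\<^sup>+y. 1 \<partial>M2)" by (intro nn_integral_cong eq2)
    finally show ?thesis by (simp add: M2.emeasure_space_1)
  qed
  have chebyshev: "c / 2 \<le> measure M {x\<in>space M. c / 2 \<le> u x}"
    if M: "prob_space M" and [measurable]: "u \<in> borel_measurable M"
      and I: "(\<integral>\<^sup>+x. ennreal (u x) \<partial>M) + ennreal (mass f g) = 1"
      and u1: "\<And>x. x \<in> space M \<Longrightarrow> u x \<le> 1" for M :: "'c measure" and u
  proof -
    interpret M: prob_space M by fact
    let ?A = "{x\<in>space M. c / 2 \<le> u x}"
    have "(\<integral>\<^sup>+x. ennreal (u x) \<partial>M) \<le> (\<integral>\<^sup>+x. indicator ?A x + ennreal (c / 2) \<partial>M)"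
      using u1 c by (intro nn_integral_mono) (auto simp: indicator_def intro: add_increasing2)
    also have "\<dots> = ennreal (M.prob ?A + c / 2)"
      using c by (subst nn_integral_add) (auto simp: M.emeasure_eq_measure M.prob_space)
    finally have "1 \<le> ennreal (M.prob ?A + c / 2) + ennreal (mass f g)"
      unfolding I[symmetric] by (intro add_right_mono)
    also have "\<dots> = ennreal (M.prob ?A + c / 2 + mass f g)"
      using c mass_nonneg by (subst ennreal_plus) auto
    finally have "1 \<le> M.prob ?A + c / 2 + mass f g"
      by (simp add: ennreal_ge_1)
    then show ?thesis using def by simp
  qed
  have "e * f x \<le> 1" if "x \<in> space M1" for x
  proof -
    have "ennreal (e * f x) \<le> 1" unfolding eq1[OF that, symmetric] by simp
    then show ?thesis by simp
  qed
  then show "c / 2 \<le> M1.prob {x\<in>space M1. c / 2 \<le> e * f x}"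
    by (intro chebyshev M1.prob_space_axioms I1) auto
  have "e * g y \<le> 1" if "y \<in> space M2" for y
  proof -
    have "ennreal (e * g y) \<le> 1" unfolding eq2[OF that, symmetric] by simp
    then show ?thesis by simp
  qed
  then show "c / 2 \<le> M2.prob {y\<in>space M2. c / 2 \<le> e * g y}"
    by (intro chebyshev M2.prob_space_axioms I2) auto
qed

text \<open>If the deficit stayed above \<open>c\<close>, then \<open>f\<close> and \<open>g\<close> would be of order \<open>1/e\<close> on sets of mass \<open>c/2\<close>. The
scaled kernel would then be of order \<open>1/e\<^sup>2\<close> on a set of mass bounded below, which contradicts its
total mass being at most \<open>1\<close>.\<close>

lemma regularised_mass_tendsto:
  assumes c: "0 < c"
  obtains e0 where "0 < e0"
    "\<And>e f g. 0 < e \<Longrightarrow> e < e0 \<Longrightarrow> regularised e f g \<Longrightarrow> 1 - c \<le> mass f g"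
proof -
  let ?P = "M1 \<Otimes>\<^sub>M M2"
  obtain n :: nat where n: "prob {z\<in>space ?P. h z < inverse (real (Suc n))} < c\<^sup>2 / 8"
    using positive_bounded_below[OF h_measurable, of "c\<^sup>2 / 8"] h_pos c by auto
  define \<kappa> where "\<kappa> = inverse (real (Suc n))"
  have \<kappa>: "0 < \<kappa>" by (simp add: \<kappa>_def)
  \<comment> \<open>At this \<open>e0\<close> the lower bound \<open>(c / (2 e))\<^sup>2 \<kappa> c\<^sup>2 / 8\<close> for the mass reaches \<open>1\<close>.\<close>
  define e0 where "e0 = sqrt (\<kappa> * c ^ 4 / 32)"
  show thesis
  proof (rule that[of e0])
    show "0 < e0" using \<kappa> c by (simp add: e0_def)
    fix e f g assume e: "0 < e" "e < e0" and reg: "regularised e f g"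
    have [measurable]: "f \<in> borel_measurable M1" "g \<in> borel_measurable M2"
      and pos: "\<And>x. 0 < f x" "\<And>y. 0 < g y"
      using reg by (auto simp: regularised_def)
    show "1 - c \<le> mass f g"
    proof (rule ccontr)
      assume "\<not> 1 - c \<le> mass f g"
      then have def: "mass f g < 1 - c" by simp
      define A where "A = {x\<in>space M1. c / 2 \<le> e * f x}"
      define B where "B = {y\<in>space M2. c / 2 \<le> e * g y}"
      define D where "D = {z\<in>space ?P. h z < \<kappa>}"
      have [measurable]: "A \<in> sets M1" "B \<in> sets M2" "D \<in> sets ?P"
        unfolding A_def B_def D_def by measurable
      have AB: "c / 2 \<le> M1.prob A" "c / 2 \<le> M2.prob B"
        using regularised_mass_deficit[OF reg e(1) c def] by (auto simp: A_def B_def)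
      have "(c / 2) * (c / 2) \<le> M1.prob A * M2.prob B"
        using AB c by (intro mult_mono) auto
      also have "\<dots> = prob (A \<times> B)"
        by (simp add: measure_def M2.emeasure_pair_measure_Times enn2real_mult)
      also have "\<dots> \<le> prob ((A \<times> B - D) \<union> D)" by (intro P.finite_measure_mono) auto
      also have "\<dots> \<le> prob (A \<times> B - D) + prob D" by (intro measure_Un_le) auto
      finally have big: "c\<^sup>2 / 8 \<le> prob (A \<times> B - D)"
        using n by (simp add: D_def \<kappa>_def power2_eq_square)
      define r where "r = (c / (2 * e))\<^sup>2 * \<kappa>"
      have r: "0 \<le> r" using \<kappa> by (simp add: r_def)
      have pt: "r * indicator (A \<times> B - D) z \<le> scaled f g z" for z
      proof (cases "z \<in> A \<times> B - D")
        case True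
        then obtain x y where z: "z = (x, y)" "x \<in> A" "y \<in> B" by auto
        have "c / (2 * e) \<le> f x" "c / (2 * e) \<le> g y"
          using z e by (auto simp: A_def B_def field_simps)
        then have "(c / (2 * e)) * (c / (2 * e)) \<le> f x * g y"
          using c e pos by (intro mult_mono) (auto simp: less_imp_le)
        moreover have "\<kappa> \<le> h z" using True z by (auto simp: A_def B_def D_def space_pair_measure)
        ultimately have "(c / (2 * e)) * (c / (2 * e)) * \<kappa> \<le> f x * g y * h z"
          using \<kappa> pos by (intro mult_mono[of "c / (2 * e) * (c / (2 * e))"]) (auto simp: less_imp_le)
        then show ?thesis using True by (simp add: r_def scaled_def z power2_eq_square)
      qed (use pos h_pos in \<open>simp add: scaled_def less_imp_le\<close>)
      have sub: "submarginals M1 M2 (scaled f g)"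
        by (intro subscaling_imp_submarginals regularised_imp_subscaling[OF reg])
      have "r * (c\<^sup>2 / 8) \<le> r * prob (A \<times> B - D)"
        using big r by (intro mult_left_mono)
      also have "\<dots> = (\<integral>z. r * indicator (A \<times> B - D) z \<partial>?P)" by simp
      also have "\<dots> \<le> mass f g"
      proof (intro integral_mono pt submarginals_integrable(1)[OF sub] integrable_mult_right)
        show "integrable ?P (indicat_real (A \<times> B - D))"
          by (intro integrable_real_indicator) (auto simp: less_top[symmetric])
      qed
      also have "\<dots> \<le> 1" by (rule submarginals_integrable(2)[OF sub])
      finally have "\<kappa> * c ^ 4 / 32 \<le> e\<^sup>2"
      proof -
        assume "r * (c\<^sup>2 / 8) \<le> 1"
        then have "r * (c\<^sup>2 / 8) * e\<^sup>2 \<le> 1 * e\<^sup>2" by (intro mult_right_mono) auto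
        moreover have "r * (c\<^sup>2 / 8) * e\<^sup>2 = \<kappa> * c ^ 4 / 32"
          using e by (simp add: r_def power_divide power_mult_distrib power4_eq_xxxx power2_eq_square)
        ultimately show ?thesis by simp
      qed
      moreover have "e\<^sup>2 < e0\<^sup>2" using e by (intro power_strict_mono) auto
      moreover have "e0\<^sup>2 = \<kappa> * c ^ 4 / 32" using \<kappa> by (simp add: e0_def)
      ultimately show False by simp
    qed
  qed
qed

text \<open>Let \<open>t\<close> and \<open>s\<close> be quartiles of \<open>f\<close> and \<open>g\<close>. From \<open>g(y) \<integral> h f \<le> 1\<close> and \<open>f \<ge> t\<close> on a quarter of the
space, \<open>g t\<close> is bounded by a function of the kernel alone, and likewise \<open>f s\<close>. A scaled kernel with
mass at least \<open>3/4\<close> puts mass \<open>1/4\<close> on \<open>{f \<le> 2t} \<times> {g \<le> 2s}\<close>, where it is at most \<open>4 t s h\<close>;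
hence \<open>t s \<ge> 1/16\<close> and the bound on \<open>f s\<close> turns into one on \<open>f / t\<close>.\<close>

lemma uniform_scaling_bounds:
  obtains \<alpha> \<beta> where "\<alpha> \<in> borel_measurable M1" "\<beta> \<in> borel_measurable M2"
    "\<And>x. 0 < \<alpha> x" "\<And>x. \<alpha> x \<le> 1" "\<And>y. 0 < \<beta> y" "\<And>y. \<beta> y \<le> 1"
    "\<And>f g. subscaling f g \<Longrightarrow> 3/4 \<le> mass f g \<Longrightarrow>
       \<exists>t>0. (\<forall>x\<in>space M1. f x / t * \<alpha> x \<le> 16) \<and> (\<forall>y\<in>space M2. g y * t * \<beta> y \<le> 1)"
proof -
  let ?P = "M1 \<Otimes>\<^sub>M M2"
  obtain \<alpha> where \<alpha>: "\<alpha> \<in> borel_measurable M1" "\<And>x. 0 < \<alpha> x" "\<And>x. \<alpha> x \<le> 1"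
    and \<alpha>_low: "\<And>x B. x \<in> space M1 \<Longrightarrow> B \<in> sets M2 \<Longrightarrow> 1/4 \<le> M2.prob B \<Longrightarrow>
       ennreal (\<alpha> x) \<le> (\<integral>\<^sup>+y. indicator B y * ennreal (h (x, y)) \<partial>M2)"
    by (rule kernel_lower_weight[OF M2.prob_space_axioms h_measurable h_pos]) (rule that)
  have swap: "(\<lambda>(y, x). h (x, y)) \<in> borel_measurable (M2 \<Otimes>\<^sub>M M1)" by measurable
  have "0 < (\<lambda>(y, x). h (x, y)) z" for z by (cases z) (simp add: h_pos)
  note low = kernel_lower_weight[OF M1.prob_space_axioms swap this, unfolded prod.case]
  obtain \<beta> where \<beta>: "\<beta> \<in> borel_measurable M2" "\<And>y. 0 < \<beta> y" "\<And>y. \<beta> y \<le> 1"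
    and \<beta>_low: "\<And>y A. y \<in> space M2 \<Longrightarrow> A \<in> sets M1 \<Longrightarrow> 1/4 \<le> M1.prob A \<Longrightarrow>
       ennreal (\<beta> y) \<le> (\<integral>\<^sup>+x. indicator A x * ennreal (h (x, y)) \<partial>M1)"
    by (rule low) (rule that)
  have bounds: "\<exists>t>0. (\<forall>x\<in>space M1. f x / t * \<alpha> x \<le> 16) \<and> (\<forall>y\<in>space M2. g y * t * \<beta> y \<le> 1)"
    if subs: "subscaling f g" and mass: "3/4 \<le> mass f g" for f g
  proof -
    have [measurable]: "f \<in> borel_measurable M1" "g \<in> borel_measurable M2"
      and pos: "\<And>x. 0 < f x" "\<And>y. 0 < g y"
      and le1: "\<And>x. x \<in> space M1 \<Longrightarrow> (\<integral>\<^sup>+y. ennreal (scaled f g (x, y)) \<partial>M2) \<le> 1"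
      and le2: "\<And>y. y \<in> space M2 \<Longrightarrow> (\<integral>\<^sup>+x. ennreal (scaled f g (x, y)) \<partial>M1) \<le> 1"
      using subs by (auto simp: subscaling_def)
    have sub: "submarginals M1 M2 (scaled f g)"
      by (intro subscaling_imp_submarginals subs)
    obtain t where t: "0 < t" "1/4 \<le> M1.prob {x\<in>space M1. t \<le> f x}"
        "M1.prob {x\<in>space M1. 2 * t < f x} \<le> 1/4"
      using M1.dyadic_quantile[of f] pos by auto
    obtain s where s: "0 < s" "1/4 \<le> M2.prob {y\<in>space M2. s \<le> g y}"
        "M2.prob {y\<in>space M2. 2 * s < g y} \<le> 1/4"
      using M2.dyadic_quantile[of g] pos by auto
    have g_le: "g y * t * \<beta> y \<le> 1" if y: "y \<in> space M2" for y
    proof -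
      let ?A = "{x\<in>space M1. t \<le> f x}"
      have "ennreal (g y * t * \<beta> y) = ennreal (g y * t) * ennreal (\<beta> y)"
        using pos t \<beta> by (simp add: ennreal_mult less_imp_le)
      also have "\<dots> \<le> ennreal (g y * t) * (\<integral>\<^sup>+x. indicator ?A x * ennreal (h (x, y)) \<partial>M1)"
        using t y by (intro mult_left_mono \<beta>_low) auto
      also have "\<dots> = (\<integral>\<^sup>+x. ennreal (g y * t) * (indicator ?A x * ennreal (h (x, y))) \<partial>M1)"
        using y by (intro nn_integral_cmult[symmetric]) measurable
      also have "\<dots> \<le> (\<integral>\<^sup>+x. ennreal (scaled f g (x, y)) \<partial>M1)"
      proof (intro nn_integral_mono)
        fix x
        have "t \<le> f x \<Longrightarrow> g y * t * h (x, y) \<le> f x * g y * h (x, y)"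
          using pos h_pos by (auto intro!: mult_mono simp: mult.commute less_imp_le)
        then show "ennreal (g y * t) * (indicator ?A x * ennreal (h (x, y))) \<le> ennreal (scaled f g (x, y))"
          using pos t h_pos
          by (auto simp: indicator_def scaled_def ennreal_mult[symmetric] less_imp_le intro!: ennreal_leI)
      qed
      also have "\<dots> \<le> 1" by (rule le2[OF y])
      finally show ?thesis by simp
    qed
    have f_le: "f x * s * \<alpha> x \<le> 1" if x: "x \<in> space M1" for x
    proof -
      let ?B = "{y\<in>space M2. s \<le> g y}"
      have "ennreal (f x * s * \<alpha> x) = ennreal (f x * s) * ennreal (\<alpha> x)"
        using pos s \<alpha> by (simp add: ennreal_mult less_imp_le)
      also have "\<dots> \<le> ennreal (f x * s) * (\<integral>\<^sup>+y. indicator ?B y * ennreal (h (x, y)) \<partial>M2)"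
        using s x by (intro mult_left_mono \<alpha>_low) auto
      also have "\<dots> = (\<integral>\<^sup>+y. ennreal (f x * s) * (indicator ?B y * ennreal (h (x, y))) \<partial>M2)"
        using x by (intro nn_integral_cmult[symmetric]) measurable
      also have "\<dots> \<le> (\<integral>\<^sup>+y. ennreal (scaled f g (x, y)) \<partial>M2)"
      proof (intro nn_integral_mono)
        fix y
        have "s \<le> g y \<Longrightarrow> f x * s * h (x, y) \<le> f x * g y * h (x, y)"
          using pos h_pos by (auto intro!: mult_mono simp: less_imp_le)
        then show "ennreal (f x * s) * (indicator ?B y * ennreal (h (x, y))) \<le> ennreal (scaled f g (x, y))"
          using pos s h_pos
          by (auto simp: indicator_def scaled_def ennreal_mult[symmetric] less_imp_le intro!: ennreal_leI)
      qed
      also have "\<dots> \<le> 1" by (rule le1[OF x])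
      finally show ?thesis by simp
    qed
    \<comment> \<open>Compare the mass inside and outside \<open>{f \<le> 2t} \<times> {g \<le> 2s}\<close>.\<close>
    have "1 / 16 \<le> t * s"
    proof -
      let ?p = "scaled f g"
      let ?A = "{x\<in>space M1. 2 * t < f x}" and ?B = "{y\<in>space M2. 2 * s < g y}"
      have "ennreal (3/4) \<le> ennreal (mass f g)" using mass by (rule ennreal_leI)
      also have "\<dots> = (\<integral>\<^sup>+z. ennreal (?p z) \<partial>?P)"
        by (rule submarginals_integrable(3)[OF sub, symmetric])
      also have "\<dots> \<le> (\<integral>\<^sup>+z. (indicator ?A (fst z) * ennreal (?p z) + indicator ?B (snd z) * ennreal (?p z))
          + ennreal (4 * (t * s)) * ennreal (h z) \<partial>?P)"
      proof (intro nn_integral_mono)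
        fix z assume z: "z \<in> space ?P"
        show "ennreal (?p z) \<le> (indicator ?A (fst z) * ennreal (?p z) + indicator ?B (snd z) * ennreal (?p z))
          + ennreal (4 * (t * s)) * ennreal (h z)"
        proof (cases "fst z \<in> ?A \<or> snd z \<in> ?B")
          case True
          then show ?thesis by (auto simp: indicator_def intro: add_increasing2)
        next
          case False
          then have "f (fst z) \<le> 2 * t" "g (snd z) \<le> 2 * s"
            using z by (auto simp: space_pair_measure)
          then have "f (fst z) * g (snd z) \<le> (2 * t) * (2 * s)"
            using pos t by (intro mult_mono) (auto simp: less_imp_le)
          then have "?p z \<le> (2 * t) * (2 * s) * h z"
            unfolding scaled_def using h_pos[of z] by (intro mult_right_mono) auto
          then have "ennreal (?p z) \<le> ennreal (4 * (t * s)) * ennreal (h z)"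
            using t s h_pos[of z] by (simp add: ennreal_mult[symmetric] less_imp_le ennreal_leI mult_ac)
          then show ?thesis by (rule add_increasing[rotated]) simp
        qed
      qed
      also have "\<dots> = (\<integral>\<^sup>+z. indicator ?A (fst z) * ennreal (?p z) \<partial>?P)
          + (\<integral>\<^sup>+z. indicator ?B (snd z) * ennreal (?p z) \<partial>?P) + ennreal (4 * (t * s))"
        by (simp add: nn_integral_add nn_integral_cmult h_mass)
      also have "\<dots> \<le> (\<integral>\<^sup>+x. indicator ?A x \<partial>M1) + (\<integral>\<^sup>+y. indicator ?B y \<partial>M2) + ennreal (4 * (t * s))"
      proof (intro add_mono order_refl)
        show "(\<integral>\<^sup>+z. indicator ?A (fst z) * ennreal (?p z) \<partial>?P) \<le> (\<integral>\<^sup>+x. indicator ?A x \<partial>M1)"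
          by (rule bspec[OF conjunct1[OF conjunct2[OF conjunct2[OF sub[unfolded submarginals_def]]]]]) measurable
        show "(\<integral>\<^sup>+z. indicator ?B (snd z) * ennreal (?p z) \<partial>?P) \<le> (\<integral>\<^sup>+y. indicator ?B y \<partial>M2)"
          by (rule bspec[OF conjunct2[OF conjunct2[OF conjunct2[OF sub[unfolded submarginals_def]]]]]) measurable
      qed
      also have "\<dots> = ennreal (M1.prob ?A + M2.prob ?B + 4 * (t * s))"
        using t s by (simp add: M1.emeasure_eq_measure M2.emeasure_eq_measure)
      finally have "3/4 \<le> M1.prob ?A + M2.prob ?B + 4 * (t * s)"
        using t s by (subst (asm) ennreal_le_iff) auto
      then show ?thesis using t s by simp
    qed
    then have ts: "1 \<le> 16 * (t * s)" by simp
    have "f x / t * \<alpha> x \<le> 16" if x: "x \<in> space M1" for x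
    proof -
      have "f x / t * \<alpha> x * 1 \<le> f x / t * \<alpha> x * (16 * (t * s))"
        using ts pos(1)[of x] t \<alpha>(2)[of x] by (intro mult_left_mono) (auto simp: less_imp_le)
      also have "\<dots> = 16 * (f x * s * \<alpha> x)" using t by simp
      also have "\<dots> \<le> 16" using f_le[OF x] by simp
      finally show ?thesis by simp
    qed
    then show ?thesis using t(1) g_le by blast
  qed
  show thesis by (rule that[OF \<alpha>(1) \<beta>(1) \<alpha>(2,3) \<beta>(2,3) bounds])
qed

end

section \<open>Passage to the limit\<close>

lemma (in pair_prob_space) AE_pair_fst:
  assumes "Measurable.pred M1 Q" "AE x in M1. Q x"
  shows "AE z in M1 \<Otimes>\<^sub>M M2. Q (fst z)"
proof (rule AE_pair_measure)
  note assms(1)[measurable]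
  show "{z \<in> space (M1 \<Otimes>\<^sub>M M2). Q (fst z)} \<in> sets (M1 \<Otimes>\<^sub>M M2)" by measurable
  show "AE x in M1. AE y in M2. Q (fst (x, y))" using assms(2) by (auto elim: eventually_mono)
qed

lemma (in pair_prob_space) AE_pair_snd:
  assumes "Measurable.pred M2 Q" "AE y in M2. Q y"
  shows "AE z in M1 \<Otimes>\<^sub>M M2. Q (snd z)"
proof (rule AE_pair_measure)
  note assms(1)[measurable]
  show "{z \<in> space (M1 \<Otimes>\<^sub>M M2). Q (snd z)} \<in> sets (M1 \<Otimes>\<^sub>M M2)" by measurable
  show "AE x in M1. AE y in M2. Q (snd (x, y))" using assms(2) by simp
qed

lemma AE_not_AE_witness:
  assumes "AE x in M. Q x" "\<not> (AE x in M. \<not> Z x)"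
  obtains x where "x \<in> space M" "Q x" "Z x"
proof -
  have "\<exists>x\<in>space M. Q x \<and> Z x"
  proof (rule ccontr)
    assume none: "\<not> ?thesis"
    have "AE x in M. \<not> Z x" using assms(1) AE_space[of M] by eventually_elim (use none in blast)
    then show False using assms(2) by blast
  qed
  then show thesis using that by blast
qed

context scaling_kernel
begin

text \<open>Regularised solutions with missing mass at most \<open>1/(n + 4)\<close>, each rescaled by its own quartile. The
offset \<open>4\<close> makes every mass at least \<open>3/4\<close>, as the uniform bounds require.\<close>

lemma normalised_subscalings:
  assumes fin1: "\<And>x. x \<in> space M1 \<Longrightarrow> (\<integral>\<^sup>+y. ennreal (h (x, y)) \<partial>M2) < \<infinity>"
    and fin2: "\<And>y. y \<in> space M2 \<Longrightarrow> (\<integral>\<^sup>+x. ennreal (h (x, y)) \<partial>M1) < \<infinity>"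
  obtains \<alpha> \<beta> F G where "\<alpha> \<in> borel_measurable M1" "\<beta> \<in> borel_measurable M2"
    "\<And>x. 0 < \<alpha> x" "\<And>x. \<alpha> x \<le> 1" "\<And>y. 0 < \<beta> y" "\<And>y. \<beta> y \<le> 1"
    "\<And>n. F n \<in> borel_measurable M1" "\<And>n. G n \<in> borel_measurable M2"
    "\<And>n x. 0 < F n x" "\<And>n y. 0 < G n y"
    "\<And>n::nat. submarginals M1 M2 (scaled (F n) (G n))"
    "\<And>n. 1 - inverse (real (n + 4)) \<le> mass (F n) (G n)"
    "\<And>n x. x \<in> space M1 \<Longrightarrow> F n x * \<alpha> x \<le> 16"
    "\<And>n y. y \<in> space M2 \<Longrightarrow> G n y * \<beta> y \<le> 1"
proof -
  obtain \<alpha> \<beta> where \<alpha>\<beta>: "\<alpha> \<in> borel_measurable M1" "\<beta> \<in> borel_measurable M2"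
      "\<And>x. 0 < \<alpha> x" "\<And>x. \<alpha> x \<le> 1" "\<And>y. 0 < \<beta> y" "\<And>y. \<beta> y \<le> 1"
    and bounds: "\<And>f g. subscaling f g \<Longrightarrow> 3/4 \<le> mass f g \<Longrightarrow>
       \<exists>t>0. (\<forall>x\<in>space M1. f x / t * \<alpha> x \<le> 16) \<and> (\<forall>y\<in>space M2. g y * t * \<beta> y \<le> 1)"
    by (rule uniform_scaling_bounds) (rule that)
  let ?good = "\<lambda>n f g. f \<in> borel_measurable M1 \<and> g \<in> borel_measurable M2 \<and> (\<forall>x. 0 < f x) \<and> (\<forall>y. 0 < g y) \<and>
      submarginals M1 M2 (scaled f g) \<and> 1 - inverse (real (n + 4)) \<le> mass f g \<and>
      (\<forall>x\<in>space M1. f x * \<alpha> x \<le> 16) \<and> (\<forall>y\<in>space M2. g y * \<beta> y \<le> 1)"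
  have "\<exists>fg. ?good n (fst fg) (snd fg)" for n :: nat
  proof -
    have c: "0 < inverse (real (n + 4))" "inverse (real (n + 4)) \<le> 1/4"
      by (auto simp: field_simps)
    obtain e0 where e0: "0 < e0"
      "\<And>e f g. 0 < e \<Longrightarrow> e < e0 \<Longrightarrow> regularised e f g \<Longrightarrow> 1 - inverse (real (n + 4)) \<le> mass f g"
      by (rule regularised_mass_tendsto[OF c(1)]) (rule that)
    obtain f g where reg: "regularised (e0 / 2) f g"
      using e0(1) by (elim regularised_exists[OF fin1 fin2, rotated -1]) auto
    have mass: "1 - inverse (real (n + 4)) \<le> mass f g"
      using e0(1) by (intro e0(2)[OF _ _ reg]) auto
    note subs = regularised_imp_subscaling[OF reg]
    obtain t where t: "0 < t" "\<forall>x\<in>space M1. f x / t * \<alpha> x \<le> 16" "\<forall>y\<in>space M2. g y * t * \<beta> y \<le> 1"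
      using bounds[OF subs] mass c(2) by auto
    have eq: "scaled (\<lambda>x. f x / t) (\<lambda>y. g y * t) = scaled f g"
      using t(1) by (auto simp: scaled_def)
    have "?good n (\<lambda>x. f x / t) (\<lambda>y. g y * t)"
      unfolding eq using subs t mass subscaling_imp_submarginals[OF subs]
      by (auto simp: subscaling_def)
    then show ?thesis by (intro exI[of _ "(\<lambda>x. f x / t, \<lambda>y. g y * t)"]) simp
  qed
  then have "\<forall>n. \<exists>fg. ?good n (fst fg) (snd fg)" by blast
  from choice[OF this] obtain FG where "\<forall>n. ?good n (fst (FG n)) (snd (FG n))" by blast
  then show thesis
    by (intro that[of \<alpha> \<beta> "\<lambda>n. fst (FG n)" "\<lambda>n. snd (FG n)"] \<alpha>\<beta>) auto
qed

text \<open>By the uniform bounds the denominator in the comparison of the \<open>i\<close>-th and the \<open>j\<close>-th scaling is at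
most \<open>64/(\<alpha> \<beta>)\<close>. Therefore the products \<open>F i * G i\<close> are Cauchy in \<open>L\<^sup>2\<close> of the finite measure with
density \<open>h \<alpha> \<beta>\<close>, hence also in \<open>L\<^sup>1\<close>, and a subsequence converges almost everywhere.\<close>

lemma subscalings_converge:
  assumes \<alpha>\<beta>[measurable]: "\<alpha> \<in> borel_measurable M1" "\<beta> \<in> borel_measurable M2"
    and \<alpha>: "\<And>x. 0 < \<alpha> x" "\<And>x. \<alpha> x \<le> 1" and \<beta>: "\<And>y. 0 < \<beta> y" "\<And>y. \<beta> y \<le> 1"
    and FG[measurable]: "\<And>n. F n \<in> borel_measurable M1" "\<And>n. G n \<in> borel_measurable M2"
    and pos: "\<And>n x. 0 < F n x" "\<And>n y. 0 < G n y"
    and sub: "\<And>n::nat. submarginals M1 M2 (scaled (F n) (G n))"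
    and mass: "\<And>n. 1 - inverse (real (n + 4)) \<le> mass (F n) (G n)"
    and bounds: "\<And>n x. x \<in> space M1 \<Longrightarrow> F n x * \<alpha> x \<le> 16" "\<And>n y. y \<in> space M2 \<Longrightarrow> G n y * \<beta> y \<le> 1"
  obtains r :: "nat \<Rightarrow> nat" where "strict_mono r"
    "AE z in M1 \<Otimes>\<^sub>M M2. Cauchy (\<lambda>i. F (r i) (fst z) * G (r i) (snd z))"
proof -
  let ?P = "M1 \<Otimes>\<^sub>M M2"
  define w where "w z = h z * (\<alpha> (fst z) * \<beta> (snd z))" for z
  define q where "q n z = F n (fst z) * G n (snd z)" for n z
  have [measurable]: "w \<in> borel_measurable ?P" "q n \<in> borel_measurable ?P" for n
    unfolding w_def[abs_def] q_def[abs_def] by measurable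
  have w_pos: "0 < w z" for z using h_pos \<alpha> \<beta> by (simp add: w_def)
  have w_le: "w z \<le> h z" for z
  proof -
    have "\<alpha> (fst z) * \<beta> (snd z) \<le> 1" using \<alpha> \<beta> by (intro mult_le_one) (auto simp: less_imp_le)
    then show ?thesis using h_pos[of z] by (simp add: w_def mult_left_le)
  qed
  have h_int: "integrable ?P h" "(\<integral>z. h z \<partial>?P) = 1"
    using h_mass h_pos by (auto intro!: integrableI_nonneg simp: integral_eq_nn_integral less_imp_le)
  have w_int: "integrable ?P w"
    using w_le w_pos by (intro Bochner_Integration.integrable_bound[OF h_int(1)])
      (auto simp: less_imp_le abs_of_pos intro!: AE_I2 order_trans[OF w_le])
  have w_le1: "(\<integral>z. w z \<partial>?P) \<le> 1"
    unfolding h_int(2)[symmetric] by (intro integral_mono w_int h_int w_le)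
  have s_int: "integrable ?P (\<lambda>z. q n z * w z)" for n
  proof (rule Bochner_Integration.integrable_bound[OF submarginals_integrable(1)[OF sub[of n]]])
    have "\<bar>q n z * w z\<bar> \<le> \<bar>scaled (F n) (G n) z\<bar>" for z
      using w_le[of z] w_pos[of z] pos[of n] h_pos[of z]
      by (auto simp: q_def scaled_def abs_mult intro!: mult_left_mono)
    then show "AE z in ?P. norm (q n z * w z) \<le> norm (scaled (F n) (G n) z)" by simp
  qed measurable
  have dist: "(\<integral>z. norm (q i z * w z - q j z * w z) \<partial>?P)
      \<le> 64 / \<eta> * (inverse (real (i + 4)) + inverse (real (j + 4))) + \<eta>" if \<eta>: "0 < \<eta>" for i j \<eta>
  proof -
    define E where "E z = h z * (F i (fst z) * G i (snd z) - F j (fst z) * G j (snd z))\<^sup>2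
      / ((F i (fst z) + F j (fst z)) * (G i (snd z) + G j (snd z)))" for z
    have E_int: "integrable ?P E" and E_le: "(\<integral>z. E z \<partial>?P) \<le> 2 - mass (F i) (G i) - mass (F j) (G j)"
      unfolding E_def using scaled_difference_bound[OF sub[of i] sub[of j] FG(1)[of i] FG(1)[of j] FG(2)[of i] FG(2)[of j]] pos by auto
    have pt: "norm (q i z * w z - q j z * w z) \<le> 64 / \<eta> * E z + \<eta> * w z" if z: "z \<in> space ?P" for z
    proof -
      obtain x y where xy: "z = (x, y)" "x \<in> space M1" "y \<in> space M2"
        using z by (auto simp: space_pair_measure)
      define d where "d = q i z - q j z"
      define k where "k = (F i x + F j x) * (G i y + G j y)"
      have k: "0 < k" using pos by (auto simp: k_def intro!: mult_pos_pos add_pos_pos)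
      have "(F i x + F j x) * \<alpha> x \<le> 32"
        using bounds(1)[OF xy(2), of i] bounds(1)[OF xy(2), of j] by (simp add: distrib_right)
      moreover have "(G i y + G j y) * \<beta> y \<le> 2"
        using bounds(2)[OF xy(3), of i] bounds(2)[OF xy(3), of j] by (simp add: distrib_right)
      moreover have "0 < (G i y + G j y) * \<beta> y"
        using pos \<beta> by (intro mult_pos_pos add_pos_pos) auto
      ultimately have "(F i x + F j x) * \<alpha> x * ((G i y + G j y) * \<beta> y) \<le> 32 * 2"
        by (intro mult_mono) auto
      then have kab: "k * (\<alpha> x * \<beta> y) \<le> 64" by (simp add: k_def mult_ac)
      have "w z * d\<^sup>2 = (k * (\<alpha> x * \<beta> y)) * (h z * d\<^sup>2 / k)"
        using k by (simp add: w_def xy)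
      also have "\<dots> \<le> 64 * (h z * d\<^sup>2 / k)"
        using k h_pos[of z] by (intro mult_right_mono kab) (auto intro!: divide_nonneg_pos mult_nonneg_nonneg less_imp_le)
      also have "h z * d\<^sup>2 / k = E z" by (simp add: E_def d_def k_def q_def xy)
      finally have wd: "w z * d\<^sup>2 \<le> 64 * E z" .
      \<comment> \<open>This elementary inequality replaces Cauchy--Schwarz in the passage from \<open>L\<^sup>2\<close> to \<open>L\<^sup>1\<close>.\<close>
      have "\<bar>d\<bar> \<le> d\<^sup>2 / \<eta> + \<eta>"
      proof (cases "\<bar>d\<bar> \<le> \<eta>")
        case True
        then show ?thesis using \<eta> by (intro add_increasing) auto
      next
        case False
        then have "\<bar>d\<bar> * \<eta> \<le> \<bar>d\<bar> * \<bar>d\<bar>" by (intro mult_left_mono) auto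
        then have "\<bar>d\<bar> \<le> d\<^sup>2 / \<eta>"
          using \<eta> by (simp add: pos_le_divide_eq power2_eq_square)
        then show ?thesis using \<eta> by (intro add_increasing2) auto
      qed
      then have "w z * \<bar>d\<bar> \<le> w z * (d\<^sup>2 / \<eta> + \<eta>)" using w_pos[of z] by (intro mult_left_mono) auto
      also have "\<dots> = w z * d\<^sup>2 / \<eta> + \<eta> * w z" by (simp add: algebra_simps)
      also have "\<dots> \<le> 64 * E z / \<eta> + \<eta> * w z"
        using wd \<eta> by (intro add_right_mono divide_right_mono) auto
      finally have "w z * \<bar>d\<bar> \<le> 64 * E z / \<eta> + \<eta> * w z" .
      moreover have "q i z * w z - q j z * w z = w z * d" by (simp add: d_def algebra_simps)
      ultimately show ?thesis using w_pos[of z] by (simp add: abs_mult)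
    qed
    have "(\<integral>z. norm (q i z * w z - q j z * w z) \<partial>?P) \<le> (\<integral>z. 64 / \<eta> * E z + \<eta> * w z \<partial>?P)"
      using s_int E_int w_int pt by (intro integral_mono) auto
    also have "\<dots> = 64 / \<eta> * (\<integral>z. E z \<partial>?P) + \<eta> * (\<integral>z. w z \<partial>?P)"
      using E_int w_int by simp
    also have "\<dots> \<le> 64 / \<eta> * (inverse (real (i + 4)) + inverse (real (j + 4))) + \<eta> * 1"
      using E_le mass[of i] mass[of j] w_le1 \<eta> by (intro add_mono mult_left_mono) auto
    finally show ?thesis by simp
  qed
  have cauchy: "\<exists>N. \<forall>i\<ge>N. \<forall>j\<ge>N. (\<integral>z. norm (q i z * w z - q j z * w z) \<partial>?P) < e" if e: "0 < e" for e
  proof -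
    \<comment> \<open>With \<open>\<eta> = e / 2\<close> the first term of the distance bound is then at most \<open>e / 4\<close>.\<close>
    obtain N :: nat where N: "inverse (real (Suc N)) < e\<^sup>2 / 1024"
      using reals_Archimedean[of "e\<^sup>2 / 1024"] e by auto
    have "(\<integral>z. norm (q i z * w z - q j z * w z) \<partial>?P) < e" if ij: "N \<le> i" "N \<le> j" for i j
    proof -
      have small: "inverse (real (l + 4)) \<le> e\<^sup>2 / 1024" if "N \<le> l" for l
      proof -
        have "inverse (real (l + 4)) \<le> inverse (real (Suc N))"
          using that by (intro le_imp_inverse_le) auto
        also have "\<dots> \<le> e\<^sup>2 / 1024" using N by (rule less_imp_le)
        finally show ?thesis .
      qed
      have "(\<integral>z. norm (q i z * w z - q j z * w z) \<partial>?P)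
          \<le> 64 / (e / 2) * (inverse (real (i + 4)) + inverse (real (j + 4))) + e / 2"
        using e by (intro dist) auto
      also have "\<dots> \<le> 64 / (e / 2) * (e\<^sup>2 / 512) + e / 2"
        using small[OF ij(1)] small[OF ij(2)] e by (intro add_right_mono mult_left_mono) auto
      also have "\<dots> < e" using e by (simp add: power2_eq_square)
      finally show ?thesis .
    qed
    then show ?thesis by blast
  qed
  obtain r where r: "strict_mono r" "AE z in ?P. Cauchy (\<lambda>i. q (r i) z * w z)"
    using cauchy_L1_AE_cauchy_subseq[OF s_int cauchy] by blast
  have "AE z in ?P. Cauchy (\<lambda>i. q (r i) z)"
    using r(2)
  proof eventually_elim
    case (elim z)
    then obtain l where "(\<lambda>i. q (r i) z * w z) \<longlonglongrightarrow> l"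
      unfolding Cauchy_convergent_iff convergent_def by blast
    then have "(\<lambda>i. q (r i) z * w z / w z) \<longlonglongrightarrow> l / w z"
      using w_pos[of z] by (intro tendsto_divide tendsto_const) auto
    then have "(\<lambda>i. q (r i) z) \<longlonglongrightarrow> l / w z" using w_pos[of z] by simp
    then show ?case by (rule LIMSEQ_imp_Cauchy)
  qed
  then show thesis using that[OF r(1)] by (simp add: q_def)
qed

end

lemma ennreal_dominated_sum_eq:
  fixes a b a' b' :: ennreal
  assumes "a \<le> a'" "b \<le> b'" "a' + b' = 1" "1 \<le> a + b"
  shows "a = a'"
proof (rule antisym)
  have "b' + a' \<le> a + b" using assms by (simp add: add.commute)
  also have "\<dots> \<le> b' + a" using assms(2) by (simp add: add.commute add_right_mono)
  finally have "b' = \<infinity> \<or> a' \<le> a" by (simp add: ennreal_add_left_cancel_le)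
  moreover have "b' \<noteq> \<infinity>" using assms(3) by auto
  ultimately show "a' \<le> a" by simp
qed fact

context scaling_kernel
begin

text \<open>Fatou's lemma shows that the marginals of the limit are dominated by \<open>M1\<close> and \<open>M2\<close>. No mass is lost:
where the weights \<open>\<alpha>\<close> and \<open>\<beta>\<close> exceed constants, the scaled kernels are dominated by a multiple of
\<open>h\<close>, and the complement is a union of a strip over a small subset of the first space and one over a
small subset of the second, whose masses are controlled by the marginals. Dominated marginals of full
mass are equal to the prescribed ones.\<close>

lemma limit_of_subscalings:
  assumes \<alpha>\<beta>[measurable]: "\<alpha> \<in> borel_measurable M1" "\<beta> \<in> borel_measurable M2"
    and \<alpha>: "\<And>x. 0 < \<alpha> x" and \<beta>: "\<And>y. 0 < \<beta> y"
    and FG[measurable]: "\<And>n. F n \<in> borel_measurable M1" "\<And>n. G n \<in> borel_measurable M2"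
    and pos: "\<And>n x. 0 < F n x" "\<And>n y. 0 < G n y"
    and sub: "\<And>n::nat. submarginals M1 M2 (scaled (F n) (G n))"
    and mass: "(\<lambda>n. mass (F n) (G n)) \<longlonglongrightarrow> 1"
    and bounds: "\<And>n x. x \<in> space M1 \<Longrightarrow> F n x * \<alpha> x \<le> 16" "\<And>n y. y \<in> space M2 \<Longrightarrow> G n y * \<beta> y \<le> 1"
    and L[measurable]: "L \<in> borel_measurable (M1 \<Otimes>\<^sub>M M2)" and L_nonneg: "\<And>z. 0 \<le> L z"
    and lim: "AE z in M1 \<Otimes>\<^sub>M M2. (\<lambda>i. F i (fst z) * G i (snd z)) \<longlonglongrightarrow> L z"
  shows "A \<in> sets M1 \<Longrightarrow>
      (\<integral>\<^sup>+z. indicator A (fst z) * ennreal (L z * h z) \<partial>(M1 \<Otimes>\<^sub>M M2)) = emeasure M1 A"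
    and "B \<in> sets M2 \<Longrightarrow>
      (\<integral>\<^sup>+z. indicator B (snd z) * ennreal (L z * h z) \<partial>(M1 \<Otimes>\<^sub>M M2)) = emeasure M2 B"
proof -
  let ?P = "M1 \<Otimes>\<^sub>M M2"
  let ?p = "\<lambda>n z. ennreal (scaled (F n) (G n) z)" and ?q = "\<lambda>z. ennreal (L z * h z)"
  have [measurable]: "scaled (F n) (G n) \<in> borel_measurable ?P" for n by measurable
  have p_lim: "AE z in ?P. (\<lambda>n. ?p n z) \<longlonglongrightarrow> ?q z"
    using lim by eventually_elim (auto simp: scaled_def intro!: tendsto_ennrealI tendsto_mult_right)
  have sub1: "(\<integral>\<^sup>+z. indicator A (fst z) * ?p n z \<partial>?P) \<le> emeasure M1 A" if A[measurable]: "A \<in> sets M1" for A n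
  proof -
    have "(\<integral>\<^sup>+z. indicator A (fst z) * ?p n z \<partial>?P) \<le> (\<integral>\<^sup>+x. indicator A x \<partial>M1)"
      by (rule bspec[OF conjunct1[OF conjunct2[OF conjunct2[OF sub[unfolded submarginals_def]]]]]) measurable
    then show ?thesis by simp
  qed
  have sub2: "(\<integral>\<^sup>+z. indicator B (snd z) * ?p n z \<partial>?P) \<le> emeasure M2 B" if B[measurable]: "B \<in> sets M2" for B n
  proof -
    have "(\<integral>\<^sup>+z. indicator B (snd z) * ?p n z \<partial>?P) \<le> (\<integral>\<^sup>+y. indicator B y \<partial>M2)"
      by (rule bspec[OF conjunct2[OF conjunct2[OF conjunct2[OF sub[unfolded submarginals_def]]]]]) measurable
    then show ?thesis by simp
  qed
  have fatou: "(\<integral>\<^sup>+z. indicator C z * ?q z \<partial>?P) \<le> m"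
    if [measurable]: "C \<in> sets ?P" and le: "\<And>n. (\<integral>\<^sup>+z. indicator C z * ?p n z \<partial>?P) \<le> m" for C m
  proof -
    have "(\<integral>\<^sup>+z. indicator C z * ?q z \<partial>?P) = (\<integral>\<^sup>+z. liminf (\<lambda>n. indicator C z * ?p n z) \<partial>?P)"
    proof (rule nn_integral_cong_AE)
      show "AE z in ?P. indicator C z * ?q z = liminf (\<lambda>n. indicator C z * ?p n z)"
        using p_lim
      proof eventually_elim
        case (elim z)
        have "(\<lambda>n. indicator C z * ?p n z) \<longlonglongrightarrow> indicator C z * ?q z"
          using elim by (intro ennreal_tendsto_cmult) (auto simp: indicator_def)
        then show ?case by (intro lim_imp_Liminf[symmetric]) auto
      qed
    qed
    also have "\<dots> \<le> liminf (\<lambda>n. \<integral>\<^sup>+z. indicator C z * ?p n z \<partial>?P)"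
      by (rule nn_integral_liminf) measurable
    also have "\<dots> \<le> m"
      by (intro order_trans[OF Liminf_le_Limsup] Limsup_bounded always_eventually allI le) auto
    finally show ?thesis .
  qed
  have le1: "(\<integral>\<^sup>+z. indicator A (fst z) * ?q z \<partial>?P) \<le> emeasure M1 A" if A[measurable]: "A \<in> sets M1" for A
  proof -
    have eq: "(\<integral>\<^sup>+z. indicator A (fst z) * g z \<partial>?P) = (\<integral>\<^sup>+z. indicator (A \<times> space M2) z * g z \<partial>?P)" for g
      by (intro nn_integral_cong) (auto simp: indicator_def space_pair_measure)
    show ?thesis
      unfolding eq using sub1[OF A] unfolding eq by (intro fatou) auto
  qed
  have le2: "(\<integral>\<^sup>+z. indicator B (snd z) * ?q z \<partial>?P) \<le> emeasure M2 B" if B[measurable]: "B \<in> sets M2" for B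
  proof -
    have eq: "(\<integral>\<^sup>+z. indicator B (snd z) * g z \<partial>?P) = (\<integral>\<^sup>+z. indicator (space M1 \<times> B) z * g z \<partial>?P)" for g
      by (intro nn_integral_cong) (auto simp: indicator_def space_pair_measure)
    show ?thesis
      unfolding eq using sub2[OF B] unfolding eq by (intro fatou) auto
  qed
  have full: "1 \<le> (\<integral>\<^sup>+z. ?q z \<partial>?P)"
  proof (rule ennreal_le_epsilon)
    fix e :: real assume e: "0 < e"
    \<comment> \<open>Cut off the two strips where the uniform bounds are poor.\<close>
    obtain k :: nat where k: "M1.prob {x\<in>space M1. \<alpha> x < inverse (real (Suc k))} < e / 2"
      using M1.positive_bounded_below[of \<alpha> "e / 2"] \<alpha> e by auto
    obtain l :: nat where l: "M2.prob {y\<in>space M2. \<beta> y < inverse (real (Suc l))} < e / 2"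
      using M2.positive_bounded_below[of \<beta> "e / 2"] \<beta> e by auto
    define a b where "a = inverse (real (Suc k))" and "b = inverse (real (Suc l))"
    have ab: "0 < a" "0 < b" by (auto simp: a_def b_def)
    define A where "A = {x\<in>space M1. \<alpha> x < a}"
    define B where "B = {y\<in>space M2. \<beta> y < b}"
    define C where "C = {z\<in>space ?P. a \<le> \<alpha> (fst z) \<and> b \<le> \<beta> (snd z)}"
    have [measurable]: "A \<in> sets M1" "B \<in> sets M2" "C \<in> sets ?P"
      unfolding A_def B_def C_def by measurable
    have AB: "emeasure M1 A + emeasure M2 B \<le> ennreal e"
    proof -
      have "emeasure M1 A + emeasure M2 B \<le> ennreal (e / 2) + ennreal (e / 2)"
        using k l e unfolding M1.emeasure_eq_measure M2.emeasure_eq_measure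
        by (intro add_mono ennreal_leI) (auto simp: A_def B_def a_def b_def)
      also have "\<dots> = ennreal e" using e by (simp flip: ennreal_plus)
      finally show ?thesis .
    qed
    have C_bound: "scaled (F n) (G n) z \<le> 16 / (a * b) * h z" if z: "z \<in> C" for n z
    proof -
      obtain x y where xy: "z = (x, y)" "x \<in> space M1" "y \<in> space M2" "a \<le> \<alpha> x" "b \<le> \<beta> y"
        using z by (auto simp: C_def space_pair_measure)
      have "F n x * a \<le> F n x * \<alpha> x" "G n y * b \<le> G n y * \<beta> y"
        using pos xy by (auto intro!: mult_left_mono less_imp_le)
      then have "F n x \<le> 16 / a" "G n y \<le> 1 / b"
        using bounds(1)[OF xy(2), of n] bounds(2)[OF xy(3), of n] ab by (auto simp: pos_le_divide_eq)
      then have "F n x * G n y \<le> 16 / a * (1 / b)"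
        using pos ab by (intro mult_mono) (auto simp: less_imp_le)
      then have "F n x * G n y * h z \<le> 16 / a * (1 / b) * h z"
        using h_pos[of z] by (intro mult_right_mono) auto
      then show ?thesis by (simp add: scaled_def xy)
    qed
    have J: "(\<lambda>n. \<integral>\<^sup>+z. indicator C z * ?p n z \<partial>?P) \<longlonglongrightarrow> (\<integral>\<^sup>+z. indicator C z * ?q z \<partial>?P)"
    proof (rule nn_integral_dominated_convergence[where w="\<lambda>z. ennreal (16 / (a * b) * h z)"])
      show "AE z in ?P. indicator C z * ?p n z \<le> ennreal (16 / (a * b) * h z)" for n
        using C_bound by (auto simp: indicator_def intro!: AE_I2 ennreal_leI)
      have "(\<integral>\<^sup>+z. ennreal (16 / (a * b) * h z) \<partial>?P) = (\<integral>\<^sup>+z. ennreal (16 / (a * b)) * ennreal (h z) \<partial>?P)"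
        using ab h_pos by (intro nn_integral_cong ennreal_mult) (auto simp: less_imp_le)
      also have "\<dots> < \<infinity>" by (simp add: nn_integral_cmult h_mass)
      finally show "(\<integral>\<^sup>+z. ennreal (16 / (a * b) * h z) \<partial>?P) < \<infinity>" .
      show "AE z in ?P. (\<lambda>n. indicator C z * ?p n z) \<longlonglongrightarrow> indicator C z * ?q z"
        using p_lim by eventually_elim (intro ennreal_tendsto_cmult, auto simp: indicator_def)
    qed measurable
    have step: "ennreal (mass (F n) (G n)) \<le> (\<integral>\<^sup>+z. indicator C z * ?p n z \<partial>?P) + ennreal e" for n
    proof -
      have "ennreal (mass (F n) (G n)) = (\<integral>\<^sup>+z. ?p n z \<partial>?P)"
        by (rule submarginals_integrable(3)[OF sub, symmetric])
      also have "\<dots> \<le> (\<integral>\<^sup>+z. indicator C z * ?p n z + (indicator A (fst z) * ?p n z + indicator B (snd z) * ?p n z) \<partial>?P)"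
      proof (intro nn_integral_mono)
        fix z assume z: "z \<in> space ?P"
        then consider "z \<in> C" | "fst z \<in> A" | "snd z \<in> B"
          by (force simp: A_def B_def C_def space_pair_measure not_le)
        then show "?p n z \<le> indicator C z * ?p n z + (indicator A (fst z) * ?p n z + indicator B (snd z) * ?p n z)"
          by cases (auto simp: indicator_def add_increasing add_increasing2)
      qed
      also have "\<dots> = (\<integral>\<^sup>+z. indicator C z * ?p n z \<partial>?P)
          + ((\<integral>\<^sup>+z. indicator A (fst z) * ?p n z \<partial>?P) + (\<integral>\<^sup>+z. indicator B (snd z) * ?p n z \<partial>?P))"
        by (simp add: nn_integral_add)
      also have "\<dots> \<le> (\<integral>\<^sup>+z. indicator C z * ?p n z \<partial>?P) + (emeasure M1 A + emeasure M2 B)"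
        by (intro add_left_mono add_mono sub1 sub2) measurable
      also have "\<dots> \<le> (\<integral>\<^sup>+z. indicator C z * ?p n z \<partial>?P) + ennreal e"
        by (intro add_left_mono AB)
      finally show ?thesis .
    qed
    have "ennreal 1 \<le> (\<integral>\<^sup>+z. indicator C z * ?q z \<partial>?P) + ennreal e"
      by (rule LIMSEQ_le[OF tendsto_ennrealI[OF mass] tendsto_add[OF J tendsto_const]]) (use step in blast)
    also have "\<dots> \<le> (\<integral>\<^sup>+z. ?q z \<partial>?P) + ennreal e"
      by (intro add_right_mono nn_integral_mono) (auto simp: indicator_def)
    finally show "1 \<le> (\<integral>\<^sup>+z. ?q z \<partial>?P) + ennreal e" by simp
  qed
  show "(\<integral>\<^sup>+z. indicator A (fst z) * ?q z \<partial>?P) = emeasure M1 A" if [measurable]: "A \<in> sets M1"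
  proof (rule ennreal_dominated_sum_eq)
    show "(\<integral>\<^sup>+z. indicator A (fst z) * ?q z \<partial>?P) \<le> emeasure M1 A" by (rule le1[OF that])
    show "(\<integral>\<^sup>+z. indicator (space M1 - A) (fst z) * ?q z \<partial>?P) \<le> emeasure M1 (space M1 - A)"
      by (intro le1) auto
    show "emeasure M1 A + emeasure M1 (space M1 - A) = 1"
      using M1.emeasure_space_1 that sets.sets_into_space[OF that]
      by (subst plus_emeasure) (auto simp: Un_absorb1)
    have "(\<integral>\<^sup>+z. ?q z \<partial>?P)
        = (\<integral>\<^sup>+z. indicator A (fst z) * ?q z + indicator (space M1 - A) (fst z) * ?q z \<partial>?P)"
      by (intro nn_integral_cong) (auto simp: indicator_def space_pair_measure)
    also have "\<dots> = (\<integral>\<^sup>+z. indicator A (fst z) * ?q z \<partial>?P) + (\<integral>\<^sup>+z. indicator (space M1 - A) (fst z) * ?q z \<partial>?P)"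
      by (intro nn_integral_add) measurable
    finally show "1 \<le> (\<integral>\<^sup>+z. indicator A (fst z) * ?q z \<partial>?P) + (\<integral>\<^sup>+z. indicator (space M1 - A) (fst z) * ?q z \<partial>?P)"
      using full by simp
  qed
  show "(\<integral>\<^sup>+z. indicator B (snd z) * ?q z \<partial>?P) = emeasure M2 B" if [measurable]: "B \<in> sets M2"
  proof (rule ennreal_dominated_sum_eq)
    show "(\<integral>\<^sup>+z. indicator B (snd z) * ?q z \<partial>?P) \<le> emeasure M2 B" by (rule le2[OF that])
    show "(\<integral>\<^sup>+z. indicator (space M2 - B) (snd z) * ?q z \<partial>?P) \<le> emeasure M2 (space M2 - B)"
      by (intro le2) auto
    show "emeasure M2 B + emeasure M2 (space M2 - B) = 1"
      using M2.emeasure_space_1 that sets.sets_into_space[OF that]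
      by (subst plus_emeasure) (auto simp: Un_absorb1)
    have "(\<integral>\<^sup>+z. ?q z \<partial>?P)
        = (\<integral>\<^sup>+z. indicator B (snd z) * ?q z + indicator (space M2 - B) (snd z) * ?q z \<partial>?P)"
      by (intro nn_integral_cong) (auto simp: indicator_def space_pair_measure)
    also have "\<dots> = (\<integral>\<^sup>+z. indicator B (snd z) * ?q z \<partial>?P) + (\<integral>\<^sup>+z. indicator (space M2 - B) (snd z) * ?q z \<partial>?P)"
      by (intro nn_integral_add) measurable
    finally show "1 \<le> (\<integral>\<^sup>+z. indicator B (snd z) * ?q z \<partial>?P) + (\<integral>\<^sup>+z. indicator (space M2 - B) (snd z) * ?q z \<partial>?P)"
      using full by simp
  qed
qed

text \<open>The limit of the products \<open>F i (x) * G i (y)\<close> is again a product: passing to the limit in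
\<open>q(x,y) q(x0,y0) = q(x,y0) q(x0,y)\<close> for a point with \<open>q(x0,y0) > 0\<close> whose two sections are made of
points of convergence expresses \<open>q\<close> through these sections. The factors are positive almost
everywhere because the marginals leave no mass where one of them vanishes.\<close>

lemma scaling_exists:
  assumes fin1: "\<And>x. x \<in> space M1 \<Longrightarrow> (\<integral>\<^sup>+y. ennreal (h (x, y)) \<partial>M2) < \<infinity>"
    and fin2: "\<And>y. y \<in> space M2 \<Longrightarrow> (\<integral>\<^sup>+x. ennreal (h (x, y)) \<partial>M1) < \<infinity>"
  obtains f g where "f \<in> borel_measurable M1" "g \<in> borel_measurable M2" "\<And>x. 0 < f x" "\<And>y. 0 < g y"
    "\<And>A. A \<in> sets M1 \<Longrightarrow>
      (\<integral>\<^sup>+z. indicator A (fst z) * ennreal (scaled f g z) \<partial>(M1 \<Otimes>\<^sub>M M2)) = emeasure M1 A"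
    "\<And>B. B \<in> sets M2 \<Longrightarrow>
      (\<integral>\<^sup>+z. indicator B (snd z) * ennreal (scaled f g z) \<partial>(M1 \<Otimes>\<^sub>M M2)) = emeasure M2 B"
proof -
  let ?P = "M1 \<Otimes>\<^sub>M M2"
  obtain \<alpha> \<beta> F0 G0 where \<alpha>\<beta>: "\<alpha> \<in> borel_measurable M1" "\<beta> \<in> borel_measurable M2"
    and \<alpha>: "\<And>x. 0 < \<alpha> x" "\<And>x. \<alpha> x \<le> 1" and \<beta>: "\<And>y. 0 < \<beta> y" "\<And>y. \<beta> y \<le> 1"
    and FG0: "\<And>n. F0 n \<in> borel_measurable M1" "\<And>n. G0 n \<in> borel_measurable M2"
    and pos0: "\<And>n x. 0 < F0 n x" "\<And>n y. 0 < G0 n y"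
    and sub0: "\<And>n::nat. submarginals M1 M2 (scaled (F0 n) (G0 n))"
    and mass0: "\<And>n. 1 - inverse (real (n + 4)) \<le> mass (F0 n) (G0 n)"
    and bounds0: "\<And>n x. x \<in> space M1 \<Longrightarrow> F0 n x * \<alpha> x \<le> 16" "\<And>n y. y \<in> space M2 \<Longrightarrow> G0 n y * \<beta> y \<le> 1"
    by (rule normalised_subscalings[OF fin1 fin2]) (simp, simp, rule that)
  obtain r :: "nat \<Rightarrow> nat" where r: "strict_mono r"
    and cauchy: "AE z in ?P. Cauchy (\<lambda>i. F0 (r i) (fst z) * G0 (r i) (snd z))"
    by (rule subscalings_converge[OF \<alpha>\<beta> \<alpha> \<beta> FG0 pos0 sub0 mass0 bounds0]) (assumption | rule that)+
  define F where "F i = F0 (r i)" for i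
  define G where "G i = G0 (r i)" for i
  have FG[measurable]: "F n \<in> borel_measurable M1" "G n \<in> borel_measurable M2" for n
    by (auto simp: F_def G_def FG0)
  have pos: "0 < F n x" "0 < G n y" for n x y by (auto simp: F_def G_def pos0)
  define C where "C z \<longleftrightarrow> Cauchy (\<lambda>i. F i (fst z) * G i (snd z))" for z
  define L where "L z = (if C z then lim (\<lambda>i. F i (fst z) * G i (snd z)) else 0)" for z
  have C_meas[measurable]: "Measurable.pred ?P C"
    unfolding C_def[abs_def] pred_def by (rule sets_Collect_Cauchy) measurable
  have L_meas[measurable]: "L \<in> borel_measurable ?P"
    unfolding L_def[abs_def] by measurable
  have L_lim: "(\<lambda>i. F i (fst z) * G i (snd z)) \<longlonglongrightarrow> L z" if "C z" for z
    using that by (simp add: C_def L_def Cauchy_convergent_iff convergent_LIMSEQ_iff)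
  have C_AE: "AE z in ?P. C z" using cauchy by (simp add: C_def F_def G_def)
  have L_nonneg: "0 \<le> L z" for z
  proof (cases "C z")
    case True
    show ?thesis
      by (rule LIMSEQ_le_const[OF L_lim[OF True]]) (use pos in \<open>auto simp: less_imp_le\<close>)
  qed (simp add: L_def)
  have mass: "(\<lambda>n. mass (F n) (G n)) \<longlonglongrightarrow> 1"
  proof -
    have "(\<lambda>n. 1 - inverse (real (n + 4))) \<longlonglongrightarrow> 1 - 0"
      by (intro tendsto_diff tendsto_const LIMSEQ_ignore_initial_segment[OF lim_inverse_n])
    then have low: "(\<lambda>n. 1 - inverse (real (n + 4))) \<longlonglongrightarrow> 1" by simp
    have "(\<lambda>n. mass (F0 n) (G0 n)) \<longlonglongrightarrow> 1"
      by (rule tendsto_sandwich[OF _ _ low tendsto_const])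
        (intro always_eventually allI mass0 submarginals_integrable(2)[OF sub0])+
    then show ?thesis unfolding F_def G_def
      using r by (rule LIMSEQ_subseq_LIMSEQ[unfolded comp_def])
  qed
  have lims: "AE z in ?P. (\<lambda>i. F i (fst z) * G i (snd z)) \<longlonglongrightarrow> L z"
    using C_AE by eventually_elim (rule L_lim)
  have sub: "submarginals M1 M2 (scaled (F n) (G n))" for n by (simp add: F_def G_def sub0)
  have bounds: "x \<in> space M1 \<Longrightarrow> F n x * \<alpha> x \<le> 16" "y \<in> space M2 \<Longrightarrow> G n y * \<beta> y \<le> 1" for n x y
    by (auto simp: F_def G_def bounds0)
  have marg1: "(\<integral>\<^sup>+z. indicator A (fst z) * ennreal (L z * h z) \<partial>?P) = emeasure M1 A"
    if "A \<in> sets M1" for A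
    by (rule limit_of_subscalings(1)[OF \<alpha>\<beta> \<alpha>(1) \<beta>(1) FG pos sub mass bounds L_meas L_nonneg lims]) (assumption | rule that)+
  have marg2: "(\<integral>\<^sup>+z. indicator B (snd z) * ennreal (L z * h z) \<partial>?P) = emeasure M2 B"
    if "B \<in> sets M2" for B
    by (rule limit_of_subscalings(2)[OF \<alpha>\<beta> \<alpha>(1) \<beta>(1) FG pos sub mass bounds L_meas L_nonneg lims]) (assumption | rule that)+
  \<comment> \<open>Choose a base point of positive density whose horizontal and vertical sections converge.\<close>
  have "AE x in M1. AE y in M2. C (x, y)" by (rule AE_pair[OF C_AE])
  moreover have "\<not> (AE x in M1. \<not> \<not> (AE y in M2. \<not> 0 < L (x, y)))"
  proof
    assume "AE x in M1. \<not> \<not> (AE y in M2. \<not> 0 < L (x, y))"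
    then have "AE z in ?P. \<not> 0 < L z" by (intro AE_pair_measure) auto
    then have "AE z in ?P. indicator (space M1) (fst z) * ennreal (L z * h z) = 0"
    proof eventually_elim
      case (elim z)
      then have "L z = 0" using L_nonneg[of z] by simp
      then show ?case by simp
    qed
    then have "(\<integral>\<^sup>+z. indicator (space M1) (fst z) * ennreal (L z * h z) \<partial>?P) = 0"
      by (subst nn_integral_0_iff_AE) auto
    then show False using marg1[OF sets.top] M1.emeasure_space_1 by simp
  qed
  ultimately obtain x0 where x0: "x0 \<in> space M1" "AE y in M2. C (x0, y)" "\<not> (AE y in M2. \<not> 0 < L (x0, y))"
    by (rule AE_not_AE_witness)
  have "AE y in M2. AE x in M1. C (x, y)"
    using AE_commute[of "\<lambda>x y. C (x, y)"] AE_pair[OF C_AE] by simp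
  then obtain y0 where y0: "y0 \<in> space M2" "AE x in M1. C (x, y0)" "0 < L (x0, y0)"
    using x0(3) by (rule AE_not_AE_witness)
  note [measurable] = x0(1) y0(1)
  define f where "f x = L (x, y0)" for x
  define g where "g y = L (x0, y) / L (x0, y0)" for y
  have [measurable]: "f \<in> borel_measurable M1" "g \<in> borel_measurable M2"
    unfolding f_def[abs_def] g_def[abs_def] by measurable
  have fg_nonneg: "0 \<le> f x" "0 \<le> g y" for x y
    using L_nonneg y0(3) by (auto simp: f_def g_def)
  have C0: "C (x0, y0)" using y0(3) by (auto simp: L_def split: if_splits)
  have "AE z in ?P. C (fst z, y0)"
    by (rule AE_pair_fst[OF _ y0(2)]) measurable
  moreover have "AE z in ?P. C (x0, snd z)"
    by (rule AE_pair_snd[OF _ x0(2)]) measurable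
  ultimately have L_eq: "AE z in ?P. L z = f (fst z) * g (snd z)"
    using C_AE
  proof eventually_elim
    case (elim z)
    have "(\<lambda>i. F i (fst z) * G i (snd z) * (F i x0 * G i y0)) \<longlonglongrightarrow> L z * L (x0, y0)"
      using L_lim[OF elim(3)] L_lim[OF C0] by (intro tendsto_mult) auto
    moreover have "(\<lambda>i. F i (fst z) * G i y0 * (F i x0 * G i (snd z))) \<longlonglongrightarrow> L (fst z, y0) * L (x0, snd z)"
      using L_lim[OF elim(1)] L_lim[OF elim(2)] by (intro tendsto_mult) auto
    ultimately have "L z * L (x0, y0) = L (fst z, y0) * L (x0, snd z)"
      by (intro LIMSEQ_unique) (auto simp: mult_ac)
    then show ?case using y0(3) by (simp add: f_def g_def field_simps)
  qed
  have f_pos: "AE x in M1. 0 < f x"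
  proof -
    let ?N = "{x\<in>space M1. \<not> 0 < f x}"
    have "AE z in ?P. indicator ?N (fst z) * ennreal (L z * h z) = 0"
      using L_eq
    proof eventually_elim
      case (elim z)
      show ?case
      proof (cases "0 < f (fst z)")
        case False
        then have "L z = 0" using elim fg_nonneg(1)[of "fst z"] by simp
        then show ?thesis by simp
      qed simp
    qed
    then have "(\<integral>\<^sup>+z. indicator ?N (fst z) * ennreal (L z * h z) \<partial>?P) = 0"
      by (subst nn_integral_0_iff_AE) auto
    then have "emeasure M1 ?N = 0" using marg1[of ?N] by simp
    then show ?thesis by (subst AE_iff_measurable[OF _ refl]) auto
  qed
  have g_pos: "AE y in M2. 0 < g y"
  proof -
    let ?N = "{y\<in>space M2. \<not> 0 < g y}"
    have "AE z in ?P. indicator ?N (snd z) * ennreal (L z * h z) = 0"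
      using L_eq
    proof eventually_elim
      case (elim z)
      show ?case
      proof (cases "0 < g (snd z)")
        case False
        then have "L z = 0" using elim fg_nonneg(2)[of "snd z"] by simp
        then show ?thesis by simp
      qed simp
    qed
    then have "(\<integral>\<^sup>+z. indicator ?N (snd z) * ennreal (L z * h z) \<partial>?P) = 0"
      by (subst nn_integral_0_iff_AE) auto
    then have "emeasure M2 ?N = 0" using marg2[of ?N] by simp
    then show ?thesis by (subst AE_iff_measurable[OF _ refl]) auto
  qed
  define f' where "f' x = (if 0 < f x then f x else 1)" for x
  define g' where "g' y = (if 0 < g y then g y else 1)" for y
  have [measurable]: "f' \<in> borel_measurable M1" "g' \<in> borel_measurable M2"
    unfolding f'_def[abs_def] g'_def[abs_def] by measurable
  have "AE z in ?P. 0 < f (fst z)" by (rule AE_pair_fst[OF _ f_pos]) measurable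
  moreover have "AE z in ?P. 0 < g (snd z)" by (rule AE_pair_snd[OF _ g_pos]) measurable
  ultimately have eq: "AE z in ?P. ennreal (scaled f' g' z) = ennreal (L z * h z)"
    using L_eq by eventually_elim (simp add: scaled_def f'_def g'_def)
  show thesis
  proof (rule that[of f' g'])
    show "0 < f' x" "0 < g' y" for x y by (auto simp: f'_def g'_def)
    show "(\<integral>\<^sup>+z. indicator A (fst z) * ennreal (scaled f' g' z) \<partial>?P) = emeasure M1 A" if "A \<in> sets M1" for A
      unfolding marg1[OF that, symmetric] using eq by (intro nn_integral_cong_AE) auto
    show "(\<integral>\<^sup>+z. indicator B (snd z) * ennreal (scaled f' g' z) \<partial>?P) = emeasure M2 B" if "B \<in> sets M2" for B
      unfolding marg2[OF that, symmetric] using eq by (intro nn_integral_cong_AE) auto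
  qed measurable
qed

end

section \<open>Uniqueness of scalings and the entropy gap\<close>

text \<open>For two scalings of full mass the comparison estimate has right-hand side zero.\<close>

lemma (in scaling_kernel) scaling_unique:
  assumes sub: "submarginals M1 M2 (scaled f g)" "submarginals M1 M2 (scaled f' g')"
    and [measurable]: "f \<in> borel_measurable M1" "f' \<in> borel_measurable M1"
      "g \<in> borel_measurable M2" "g' \<in> borel_measurable M2"
    and pos: "\<And>x. 0 < f x" "\<And>x. 0 < f' x" "\<And>y. 0 < g y" "\<And>y. 0 < g' y"
    and mass: "mass f g = 1" "mass f' g' = 1"
  shows "AE z in M1 \<Otimes>\<^sub>M M2. f (fst z) * g (snd z) = f' (fst z) * g' (snd z)"
proof -
  let ?P = "M1 \<Otimes>\<^sub>M M2"
  define k where "k z = (f (fst z) + f' (fst z)) * (g (snd z) + g' (snd z))" for z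
  define E where "E z = h z * (f (fst z) * g (snd z) - f' (fst z) * g' (snd z))\<^sup>2 / k z" for z
  have k: "0 < k z" for z using pos by (auto simp: k_def intro!: mult_pos_pos add_pos_pos)
  have E: "integrable ?P E" "(\<integral>z. E z \<partial>?P) \<le> 0"
    using scaled_difference_bound[OF sub assms(3-10)] mass by (simp_all add: E_def[abs_def] k_def)
  have E_nonneg: "0 \<le> E z" for z
    using k[of z] h_pos[of z] by (auto simp: E_def intro!: divide_nonneg_pos mult_nonneg_nonneg)
  have "(\<integral>z. E z \<partial>?P) = 0"
    using E(2) E_nonneg by (intro antisym integral_nonneg_AE) auto
  then have "AE z in ?P. E z = 0"
    using E(1) E_nonneg by (subst (asm) integral_nonneg_eq_0_iff_AE) auto
  then show ?thesis
  proof eventually_elim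
    case (elim z)
    then show ?case using k[of z] h_pos[of z] by (auto simp: E_def)
  qed
qed

lemma x_ln_x_lower_bound:
  fixes x :: real
  assumes "0 \<le> x"
  shows "- 1 \<le> x * ln x"
proof (cases "x = 0")
  case False
  then have x: "0 < x" using assms by simp
  have "ln (1 / x) \<le> 1 / x - 1" using x by (intro ln_le_minus_one) auto
  then have "x * ln (1 / x) \<le> x * (1 / x - 1)" using x by (intro mult_left_mono) auto
  then have "- (x * ln x) \<le> 1 - x" using x by (simp add: ln_div algebra_simps)
  then show ?thesis using x by simp
qed simp

text \<open>The bound \<open>x ln x \<ge> -1\<close> makes the subtracted integral finite, so finiteness of the extended-valued
entropy amounts to integrability, and the entropy is then a Bochner integral.\<close>

lemma relative_entropy_density:
  fixes r :: "'a \<Rightarrow> real"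
  assumes R: "prob_space R" and [measurable]: "r \<in> borel_measurable R" and r: "\<And>z. 0 \<le> r z"
  defines "\<pi> \<equiv> density R (\<lambda>z. ennreal (r z))"
  shows "relative_entropy \<pi> R < \<infinity> \<longleftrightarrow> integrable R (\<lambda>z. r z * ln (r z))"
    and "integrable R (\<lambda>z. r z * ln (r z)) \<Longrightarrow> relative_entropy \<pi> R = ereal (\<integral>z. r z * ln (r z) \<partial>R)"
proof -
  interpret R: prob_space R by fact
  let ?f = "\<lambda>z. r z * ln (r z)"
  have ac: "absolutely_continuous R \<pi>"
    unfolding \<pi>_def by (rule absolutely_continuousI_density) measurable
  have RN: "AE z in R. ennreal (r z) = RN_deriv R \<pi> z"
    by (rule R.RN_deriv_unique) (auto simp: \<pi>_def)
  have RN_meas: "RN_deriv R \<pi> \<in> borel_measurable R" by simp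
  note [measurable] = RN_meas
  have int: "(\<integral>\<^sup>+z. ennreal (c * ln (enn2real (RN_deriv R \<pi> z))) \<partial>\<pi>) = (\<integral>\<^sup>+z. ennreal (c * ?f z) \<partial>R)" for c
  proof -
    have "(\<integral>\<^sup>+z. ennreal (c * ln (enn2real (RN_deriv R \<pi> z))) \<partial>\<pi>)
        = (\<integral>\<^sup>+z. ennreal (r z) * ennreal (c * ln (enn2real (RN_deriv R \<pi> z))) \<partial>R)"
      unfolding \<pi>_def by (subst nn_integral_density) (auto simp: \<pi>_def[symmetric])
    also have "\<dots> = (\<integral>\<^sup>+z. ennreal (c * ?f z) \<partial>R)"
    proof (rule nn_integral_cong_AE)
      show "AE z in R. ennreal (r z) * ennreal (c * ln (enn2real (RN_deriv R \<pi> z))) = ennreal (c * ?f z)"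
        using RN
      proof eventually_elim
        case (elim z)
        have "enn2real (RN_deriv R \<pi> z) = r z" using r[of z] by (simp add: elim[symmetric])
        then show ?case by (simp add: ennreal_mult'[OF r, symmetric] mult_ac)
      qed
    qed
    finally show ?thesis .
  qed
  define p where "p = (\<integral>\<^sup>+z. ennreal (?f z) \<partial>R)"
  define n where "n = (\<integral>\<^sup>+z. ennreal (- ?f z) \<partial>R)"
  have H: "relative_entropy \<pi> R = enn2ereal p - enn2ereal n"
    using ac int[of 1] int[of "-1"] by (simp add: relative_entropy_def p_def n_def)
  have "n \<le> (\<integral>\<^sup>+z. 1 \<partial>R)"
    unfolding n_def using x_ln_x_lower_bound[OF r]
    by (intro nn_integral_mono) (auto simp: ennreal_le_1 intro: minus_le_iff[THEN iffD1])
  then have n: "n < top" by (simp add: R.emeasure_space_1 le_less_trans)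
  then obtain n' where n': "n = ennreal n'" "0 \<le> n'" by (cases n) auto
  have integrable_iff: "integrable R ?f \<longleftrightarrow> p < top"
    using n unfolding real_integrable_def p_def n_def by (auto simp: less_top)
  show iff: "relative_entropy \<pi> R < \<infinity> \<longleftrightarrow> integrable R ?f"
    unfolding integrable_iff H n' using n'(2)
    by (cases p) (auto simp: enn2ereal_ennreal)
  assume int_f: "integrable R ?f"
  then obtain p' where p': "p = ennreal p'" "0 \<le> p'" by (cases p) (auto simp: integrable_iff)
  have "(\<integral>z. ?f z \<partial>R) = p' - n'"
    using real_lebesgue_integral_def[OF int_f] p' n' by (simp add: p_def[symmetric] n_def[symmetric])
  then show "relative_entropy \<pi> R = ereal (\<integral>z. ?f z \<partial>R)"
    unfolding H p' n' using p'(2) n'(2) by (simp add: enn2ereal_ennreal)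
qed

text \<open>Truncation that is odd and increasing, so that \<open>clip n a + clip n b\<close> has the sign of \<open>a + b\<close>.\<close>

definition clip :: "nat \<Rightarrow> real \<Rightarrow> real" where
  "clip n x = max (- real n) (min (real n) x)"

lemma clip_measurable[measurable]: "clip n \<in> borel_measurable borel"
  unfolding clip_def[abs_def] by measurable

lemma clip_bounded: "\<bar>clip n x\<bar> \<le> real n"
  by (auto simp: clip_def)

lemma clip_sum_bounds:
  "0 \<le> a + b \<Longrightarrow> 0 \<le> clip n a + clip n b \<and> clip n a + clip n b \<le> a + b"
  "a + b \<le> 0 \<Longrightarrow> clip n a + clip n b \<le> 0 \<and> a + b \<le> clip n a + clip n b"
  by (auto simp: clip_def max_def min_def)

lemma clip_tendsto: "(\<lambda>n. clip n x) \<longlonglongrightarrow> x"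
proof (rule tendsto_eventually)
  obtain N :: nat where "\<bar>x\<bar> \<le> real N" using real_arch_simple by blast
  then have "clip n x = x" if "N \<le> n" for n using that by (auto simp: clip_def max_def min_def)
  then show "eventually (\<lambda>n. clip n x = x) sequentially"
    unfolding eventually_sequentially by blast
qed

text \<open>The integrand \<open>s ln (s / exp w)\<close> of the relative entropy between the densities \<open>s\<close> and \<open>exp w\<close>, plus
\<open>exp w - s\<close>. The extra terms integrate to zero for probability densities and make the integrand
nonnegative pointwise. At \<open>s = 0\<close> the convention \<open>ln 0 = 0\<close> gives the correct value \<open>exp w\<close>.\<close>

definition bregman :: "real \<Rightarrow> real \<Rightarrow> real" where
  "bregman s w = s * ln s - s * w - s + exp w"

text \<open>Both statements reduce to \<open>ln t \<le> t - 1\<close> for \<open>t = exp w / s\<close>, with equality only at \<open>t = 1\<close>.\<close>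

lemma bregman_nonneg: "0 \<le> s \<Longrightarrow> 0 \<le> bregman s w"
  and bregman_eq_0: "0 \<le> s \<Longrightarrow> bregman s w = 0 \<Longrightarrow> s = exp w"
proof -
  assume s: "0 \<le> s"
  have eq: "bregman s w = s * ((exp w / s - 1) - ln (exp w / s))" if "0 < s"
    using that by (simp add: bregman_def ln_div algebra_simps)
  show "0 \<le> bregman s w"
  proof (cases "s = 0")
    case False
    then have "0 < s" using s by simp
    then show ?thesis unfolding eq[OF \<open>0 < s\<close>] using ln_le_minus_one[of "exp w / s"] by simp
  qed (simp add: bregman_def)
  assume 0: "bregman s w = 0"
  have "s \<noteq> 0" using 0 by (auto simp: bregman_def)
  then have "0 < s" using s by simp
  then have "ln (exp w / s) = exp w / s - 1" using 0 unfolding eq[OF \<open>0 < s\<close>] by simp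
  then have "exp w / s = 1" using \<open>0 < s\<close> by (intro ln_eq_minus_one) auto
  then show "s = exp w" using \<open>0 < s\<close> by simp
qed

text \<open>Formally, the entropy of \<open>r'\<close> minus that of \<open>r\<close> is the integral of \<open>r' ln (r'/r)\<close>, because
\<open>ln r = ln f + ln g\<close> has the same integral against both. The two logarithms need not be integrable
separately, so they are clipped: for bounded functions the equality of the marginals applies, and
\<open>bregman (r' z) (W n z) + (r z * W n z + 1)\<close> is nonnegative with an integral that converges to the
entropy of \<open>r'\<close> plus \<open>1\<close>. Fatou's lemma then yields the inequality and both integrability claims.\<close>

lemma entropy_gap:
  fixes f :: "'a \<Rightarrow> real" and g :: "'b \<Rightarrow> real" and r' :: "'a \<times> 'b \<Rightarrow> real"
  assumes R: "prob_space R" and sets_R[measurable_cong]: "sets R = sets (M1 \<Otimes>\<^sub>M M2)"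
    and [measurable]: "f \<in> borel_measurable M1" "g \<in> borel_measurable M2" "r' \<in> borel_measurable R"
    and pos: "\<And>x. 0 < f x" "\<And>y. 0 < g y" and r': "\<And>z. 0 \<le> r' z"
  defines "r \<equiv> \<lambda>z. f (fst z) * g (snd z)"
  assumes mass: "integrable R r" "(\<integral>z. r z \<partial>R) = 1" "integrable R r'" "(\<integral>z. r' z \<partial>R) = 1"
    and marg1: "\<And>u B. u \<in> borel_measurable M1 \<Longrightarrow> (\<And>x. \<bar>u x\<bar> \<le> B) \<Longrightarrow>
      (\<integral>z. r z * u (fst z) \<partial>R) = (\<integral>z. r' z * u (fst z) \<partial>R)"
    and marg2: "\<And>v B. v \<in> borel_measurable M2 \<Longrightarrow> (\<And>y. \<bar>v y\<bar> \<le> B) \<Longrightarrow>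
      (\<integral>z. r z * v (snd z) \<partial>R) = (\<integral>z. r' z * v (snd z) \<partial>R)"
    and fin: "integrable R (\<lambda>z. r' z * ln (r' z))"
  shows "integrable R (\<lambda>z. r z * ln (r z))"
    and "integrable R (\<lambda>z. bregman (r' z) (ln (r z)))"
    and "(\<integral>z. bregman (r' z) (ln (r z)) \<partial>R) + (\<integral>z. r z * ln (r z) \<partial>R) \<le> (\<integral>z. r' z * ln (r' z) \<partial>R)"
proof -
  interpret R: prob_space R by fact
  define w where "w z = ln (f (fst z)) + ln (g (snd z))" for z
  define W where "W n z = clip n (ln (f (fst z))) + clip n (ln (g (snd z)))" for n z
  have [measurable]: "r \<in> borel_measurable R" "w \<in> borel_measurable R" "W n \<in> borel_measurable R" for n
    unfolding r_def w_def[abs_def] W_def[abs_def] by measurable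
  have r_pos: "0 < r z" for z using pos by (simp add: r_def)
  have ln_r: "ln (r z) = w z" for z using pos(1)[of "fst z"] pos(2)[of "snd z"] by (simp add: r_def w_def ln_mult)
  have exp_w: "exp (w z) = r z" for z using r_pos[of z] by (simp add: ln_r[symmetric])
  have W_lim: "(\<lambda>n. W n z) \<longlonglongrightarrow> w z" for z
    unfolding W_def w_def by (intro tendsto_add clip_tendsto)
  have W_bdd: "\<bar>W n z\<bar> \<le> 2 * real n" for n z
    using clip_bounded[of n "ln (f (fst z))"] clip_bounded[of n "ln (g (snd z))"] by (simp add: W_def)
  have W_pos: "0 \<le> w z \<Longrightarrow> 0 \<le> W n z \<and> W n z \<le> w z"
    and W_neg: "w z \<le> 0 \<Longrightarrow> W n z \<le> 0 \<and> w z \<le> W n z" for n z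
    unfolding W_def w_def by (rule clip_sum_bounds; assumption)+
  \<comment> \<open>Clipping moves \<open>w\<close> towards \<open>0\<close>, so \<open>r W n\<close> inherits the lower bound of \<open>r w = r ln r\<close>.\<close>
  have rW: "0 \<le> r z * W n z + 1" for n z
  proof (cases "0 \<le> w z")
    case True
    then show ?thesis using W_pos[of z n] r_pos[of z] by (intro add_nonneg_nonneg mult_nonneg_nonneg) auto
  next
    case False
    have "- 1 \<le> r z * w z" using x_ln_x_lower_bound[of "r z"] r_pos[of z] by (simp add: ln_r)
    also have "\<dots> \<le> r z * W n z" using False W_neg[of z n] r_pos[of z] by (intro mult_left_mono) auto
    finally show ?thesis by simp
  qed
  have expW: "exp (W n z) \<le> 1 + r z" for n z
  proof (cases "0 \<le> w z")
    case True
    then have "exp (W n z) \<le> exp (w z)" using W_pos[of z n] by simp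
    then show ?thesis by (simp add: exp_w)
  next
    case False
    then have "exp (W n z) \<le> 1" using W_neg[of z n] by simp
    also have "1 \<le> 1 + r z" using r_pos[of z] by simp
    finally show ?thesis .
  qed
  have int_clip: "integrable R (\<lambda>z. p z * clip n (ln (f (fst z))))" "integrable R (\<lambda>z. p z * clip n (ln (g (snd z))))"
    if p: "integrable R p" for p n
  proof -
    have [measurable]: "p \<in> borel_measurable R" using p by simp
    have int: "integrable R (\<lambda>z. real n * p z)" using p by simp
    have bound: "norm (p z * clip n c) \<le> norm (real n * p z)" for z c
      using mult_left_mono[OF clip_bounded[of n c], of "\<bar>p z\<bar>"] by (simp add: abs_mult mult.commute)
    show "integrable R (\<lambda>z. p z * clip n (ln (f (fst z))))"
      by (rule Bochner_Integration.integrable_bound[OF int _ AE_I2[OF bound]]) measurable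
    show "integrable R (\<lambda>z. p z * clip n (ln (g (snd z))))"
      by (rule Bochner_Integration.integrable_bound[OF int _ AE_I2[OF bound]]) measurable
  qed
  have int_W: "integrable R (\<lambda>z. p z * W n z)" if p: "integrable R p" for p n
    unfolding W_def distrib_left using int_clip[OF p] by simp
  have W_eq: "(\<integral>z. r z * W n z \<partial>R) = (\<integral>z. r' z * W n z \<partial>R)" for n
  proof -
    have "(\<integral>z. r z * clip n (ln (f (fst z))) \<partial>R) = (\<integral>z. r' z * clip n (ln (f (fst z))) \<partial>R)"
      by (rule marg1[OF _ clip_bounded]) measurable
    moreover have "(\<integral>z. r z * clip n (ln (g (snd z))) \<partial>R) = (\<integral>z. r' z * clip n (ln (g (snd z))) \<partial>R)"
      by (rule marg2[OF _ clip_bounded]) measurable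
    ultimately show ?thesis
      unfolding W_def distrib_left using int_clip[OF mass(1)] int_clip[OF mass(3)] by simp
  qed
  have int_exp: "integrable R (\<lambda>z. exp (W n z))" for n
    by (rule Bochner_Integration.integrable_bound[where f="\<lambda>z. 1 + r z"])
      (use mass(1) expW r_pos in \<open>auto simp: less_imp_le\<close>)
  have exp_lim: "(\<lambda>n. \<integral>z. exp (W n z) \<partial>R) \<longlonglongrightarrow> 1"
  proof -
    have "(\<lambda>n. \<integral>z. exp (W n z) \<partial>R) \<longlonglongrightarrow> (\<integral>z. exp (w z) \<partial>R)"
    proof (rule integral_dominated_convergence[where w="\<lambda>z. 1 + r z"])
      show "AE z in R. (\<lambda>n. exp (W n z)) \<longlonglongrightarrow> exp (w z)"
        by (intro AE_I2 tendsto_exp W_lim)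
    qed (use mass(1) expW in auto)
    then show ?thesis by (simp add: exp_w mass(2))
  qed
  define X where "X n z = bregman (r' z) (W n z) + (r z * W n z + 1)" for n z
  define Y where "Y z = bregman (r' z) (w z) + (r z * w z + 1)" for z
  have [measurable]: "X n \<in> borel_measurable R" "Y \<in> borel_measurable R" for n
    unfolding X_def[abs_def] Y_def[abs_def] bregman_def by measurable
  have X_nonneg: "0 \<le> X n z" for n z unfolding X_def by (intro add_nonneg_nonneg bregman_nonneg r' rW)
  let ?H = "\<integral>z. r' z * ln (r' z) \<partial>R"
  have X_int: "integrable R (X n)" and X_eq: "(\<integral>z. X n z \<partial>R) = ?H + (\<integral>z. exp (W n z) \<partial>R)" for n
    unfolding X_def bregman_def
    using fin int_W[OF mass(1), of n] int_W[OF mass(3), of n] int_exp[of n] mass W_eq[of n]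
    by (auto simp: R.prob_space)
  have Y_lim: "(\<lambda>n. X n z) \<longlonglongrightarrow> Y z" for z
    unfolding X_def Y_def bregman_def by (intro tendsto_intros W_lim)
  have "(\<integral>\<^sup>+z. ennreal (Y z) \<partial>R) = (\<integral>\<^sup>+z. liminf (\<lambda>n. ennreal (X n z)) \<partial>R)"
    by (intro nn_integral_cong lim_imp_Liminf[symmetric] tendsto_ennrealI Y_lim) auto
  also have "\<dots> \<le> liminf (\<lambda>n. \<integral>\<^sup>+z. ennreal (X n z) \<partial>R)"
    by (rule nn_integral_liminf) measurable
  also have "\<dots> = liminf (\<lambda>n. ennreal (?H + (\<integral>z. exp (W n z) \<partial>R)))"
    using X_int X_nonneg by (simp add: nn_integral_eq_integral X_eq)
  also have "\<dots> = ennreal (?H + 1)"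
    by (intro lim_imp_Liminf tendsto_ennrealI tendsto_add tendsto_const exp_lim) auto
  finally have Y_le: "(\<integral>\<^sup>+z. ennreal (Y z) \<partial>R) \<le> ennreal (?H + 1)" .
  have rw: "0 \<le> r z * w z + 1" for z
    using x_ln_x_lower_bound[of "r z"] r_pos[of z] by (simp add: ln_r)
  have breg: "0 \<le> bregman (r' z) (w z)" for z by (rule bregman_nonneg[OF r'])
  have Y_nonneg: "0 \<le> Y z" for z unfolding Y_def by (intro add_nonneg_nonneg rw breg)
  have Y_int: "integrable R Y"
    using Y_le Y_nonneg by (intro integrableI_nonneg) (auto intro: le_less_trans)
  have int_rw1: "integrable R (\<lambda>z. r z * w z + 1)"
    by (rule Bochner_Integration.integrable_bound[OF Y_int]) (use rw breg Y_nonneg in \<open>auto simp: Y_def\<close>)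
  then have int_rw: "integrable R (\<lambda>z. r z * w z)"
    using Bochner_Integration.integrable_diff[OF int_rw1, of "\<lambda>_. 1"] by simp
  have int_breg: "integrable R (\<lambda>z. bregman (r' z) (w z))"
    using Bochner_Integration.integrable_diff[OF Y_int int_rw1] by (simp add: Y_def)
  show "integrable R (\<lambda>z. r z * ln (r z))" using int_rw by (simp add: ln_r)
  show "integrable R (\<lambda>z. bregman (r' z) (ln (r z)))" using int_breg by (simp add: ln_r)
  have "- 1 \<le> ?H"
  proof -
    have "(\<integral>z. - 1 \<partial>R) \<le> ?H"
      by (intro integral_mono fin x_ln_x_lower_bound r') auto
    then show ?thesis by (simp add: R.prob_space)
  qed
  then have "(\<integral>z. Y z \<partial>R) \<le> ?H + 1"
    using Y_le unfolding nn_integral_eq_integral[OF Y_int AE_I2[OF Y_nonneg]]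
    by (subst (asm) ennreal_le_iff) auto
  moreover have "(\<integral>z. Y z \<partial>R) = (\<integral>z. bregman (r' z) (w z) \<partial>R) + ((\<integral>z. r z * w z \<partial>R) + 1)"
    unfolding Y_def using int_breg int_rw by (simp add: R.prob_space)
  ultimately show "(\<integral>z. bregman (r' z) (ln (r z)) \<partial>R) + (\<integral>z. r z * ln (r z) \<partial>R) \<le> ?H"
    by (simp add: ln_r)
qed

section \<open>Couplings and cyclic invariance\<close>

text \<open>The density fails to be positive or has an infinite section only on a null set, and on that set it may be
replaced by \<open>1\<close> without making any section infinite.\<close>

lemma (in pair_prob_space) positive_kernel_version:
  assumes [measurable]: "h0 \<in> borel_measurable (M1 \<Otimes>\<^sub>M M2)"
    and dens: "density (M1 \<Otimes>\<^sub>M M2) (\<lambda>z. ennreal (h0 z)) = R"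
    and R: "prob_space R" and ac: "absolutely_continuous R (M1 \<Otimes>\<^sub>M M2)"
  obtains h where "scaling_kernel M1 M2 h" "density (M1 \<Otimes>\<^sub>M M2) (\<lambda>z. ennreal (h z)) = R"
    "\<And>x. x \<in> space M1 \<Longrightarrow> (\<integral>\<^sup>+y. ennreal (h (x, y)) \<partial>M2) < \<infinity>"
    "\<And>y. y \<in> space M2 \<Longrightarrow> (\<integral>\<^sup>+x. ennreal (h (x, y)) \<partial>M1) < \<infinity>"
proof -
  let ?P = "M1 \<Otimes>\<^sub>M M2"
  interpret R: prob_space R by fact
  have mass0: "(\<integral>\<^sup>+z. ennreal (h0 z) \<partial>?P) = 1"
  proof -
    have "(\<integral>\<^sup>+z. ennreal (h0 z) \<partial>?P) = emeasure R (space R)"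
      unfolding dens[symmetric] by (simp add: emeasure_density cong: nn_integral_cong)
    then show ?thesis by (simp add: R.emeasure_space_1)
  qed
  have pos: "AE z in ?P. 0 < h0 z"
  proof -
    let ?N = "{z\<in>space ?P. \<not> 0 < h0 z}"
    have "emeasure R ?N = (\<integral>\<^sup>+z. ennreal (h0 z) * indicator ?N z \<partial>?P)"
      unfolding dens[symmetric] by (subst emeasure_density) auto
    also have "\<dots> = (\<integral>\<^sup>+z. 0 \<partial>?P)"
      by (intro nn_integral_cong) (auto simp: indicator_def ennreal_neg)
    finally have "?N \<in> null_sets R"
      unfolding dens[symmetric] by (auto simp: null_sets_def)
    then have "?N \<in> null_sets ?P" using ac by (auto simp: absolutely_continuous_def)
    then show ?thesis by (subst AE_iff_null) auto
  qed
  define K1 where "K1 x = (\<integral>\<^sup>+y. ennreal (h0 (x, y)) \<partial>M2)" for x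
  define K2 where "K2 y = (\<integral>\<^sup>+x. ennreal (h0 (x, y)) \<partial>M1)" for y
  have [measurable]: "K1 \<in> borel_measurable M1" "K2 \<in> borel_measurable M2"
    unfolding K1_def[abs_def] K2_def[abs_def] by measurable
  have "AE x in M1. K1 x \<noteq> \<infinity>"
  proof (rule nn_integral_noteq_infinite)
    have "(\<integral>\<^sup>+x. K1 x \<partial>M1) = 1" unfolding K1_def by (subst M2.nn_integral_fst) (simp_all add: mass0)
    then show "(\<integral>\<^sup>+x. K1 x \<partial>M1) \<noteq> \<infinity>" by simp
  qed measurable
  then have K1_AE: "AE z in ?P. K1 (fst z) \<noteq> \<infinity>" by (intro AE_pair_fst) measurable
  have "AE y in M2. K2 y \<noteq> \<infinity>"
  proof (rule nn_integral_noteq_infinite)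
    have "(\<integral>\<^sup>+y. K2 y \<partial>M2) = 1" unfolding K2_def by (subst nn_integral_snd) (simp_all add: mass0)
    then show "(\<integral>\<^sup>+y. K2 y \<partial>M2) \<noteq> \<infinity>" by simp
  qed measurable
  then have K2_AE: "AE z in ?P. K2 (snd z) \<noteq> \<infinity>" by (intro AE_pair_snd) measurable
  \<comment> \<open>A section that is infinite for \<open>h0\<close> is replaced as a whole; any other grows by at most \<open>1\<close>.\<close>
  define h where "h z = (if 0 < h0 z \<and> K1 (fst z) \<noteq> \<infinity> \<and> K2 (snd z) \<noteq> \<infinity> then h0 z else 1)" for z
  have [measurable]: "h \<in> borel_measurable ?P" unfolding h_def[abs_def] by measurable
  have h_eq: "AE z in ?P. h0 z = h z"
    using pos K1_AE K2_AE by eventually_elim (simp add: h_def)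
  have h_le: "ennreal (h z) \<le> ennreal (h0 z) + 1" for z
    by (auto simp: h_def)
  show thesis
  proof (rule that[of h])
    have "(\<integral>\<^sup>+z. ennreal (h z) \<partial>?P) = (\<integral>\<^sup>+z. ennreal (h0 z) \<partial>?P)"
      using h_eq by (intro nn_integral_cong_AE) auto
    then show "scaling_kernel M1 M2 h"
      by unfold_locales (auto simp: mass0 h_def)
    show "density ?P (\<lambda>z. ennreal (h z)) = R"
      unfolding dens[symmetric] using h_eq by (intro density_cong) auto
    show "(\<integral>\<^sup>+y. ennreal (h (x, y)) \<partial>M2) < \<infinity>" if x: "x \<in> space M1" for x
    proof (cases "K1 x = \<infinity>")
      case True
      then have "(\<integral>\<^sup>+y. ennreal (h (x, y)) \<partial>M2) = (\<integral>\<^sup>+y. 1 \<partial>M2)"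
        by (intro nn_integral_cong) (simp add: h_def)
      then show ?thesis by (simp add: M2.emeasure_space_1)
    next
      case False
      have "(\<integral>\<^sup>+y. ennreal (h (x, y)) \<partial>M2) \<le> (\<integral>\<^sup>+y. ennreal (h0 (x, y)) + 1 \<partial>M2)"
        by (intro nn_integral_mono h_le)
      also have "\<dots> = K1 x + 1"
        using x by (subst nn_integral_add) (auto simp: K1_def M2.emeasure_space_1)
      finally show ?thesis using False by (auto simp: less_top[symmetric] top_unique)
    qed
    show "(\<integral>\<^sup>+x. ennreal (h (x, y)) \<partial>M1) < \<infinity>" if y: "y \<in> space M2" for y
    proof (cases "K2 y = \<infinity>")
      case True
      then have "(\<integral>\<^sup>+x. ennreal (h (x, y)) \<partial>M1) = (\<integral>\<^sup>+x. 1 \<partial>M1)"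
        by (intro nn_integral_cong) (simp add: h_def)
      then show ?thesis by (simp add: M1.emeasure_space_1)
    next
      case False
      have "(\<integral>\<^sup>+x. ennreal (h (x, y)) \<partial>M1) \<le> (\<integral>\<^sup>+x. ennreal (h0 (x, y)) + 1 \<partial>M1)"
        by (intro nn_integral_mono h_le)
      also have "\<dots> = K2 y + 1"
        using y by (subst nn_integral_add) (auto simp: K2_def M1.emeasure_space_1)
      finally show ?thesis using False by (auto simp: less_top[symmetric] top_unique)
    qed
  qed
qed

text \<open>The cyclic shift only permutes the factors \<open>g (y i)\<close>.\<close>

lemma cyclic_product_factorised:
  fixes f g :: "_ \<Rightarrow> real" and k :: nat
  shows "(\<Prod>i=1..k. f (x i) * g (y i)) = (\<Prod>i=1..k. f (x i) * g (if i = k then y 1 else y (i + 1)))"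
proof -
  have "(\<Prod>i=1..k. g (if i = k then y 1 else y (i + 1))) = (\<Prod>i=1..k. g (y i))"
  proof (rule prod.reindex_bij_witness[where i="\<lambda>i. if i = 1 then k else i - 1" and j="\<lambda>i. if i = k then 1 else i + 1"])
  qed (auto split: if_splits)
  then show ?thesis by (simp add: prod.distrib)
qed

text \<open>The case \<open>k = 2\<close> with the points \<open>(x, y)\<close> and \<open>(x0, y0)\<close> expresses the density through its sections
at \<open>x0\<close> and \<open>y0\<close>.\<close>

lemma cyclically_invariant_imp_factorised:
  fixes \<pi> R :: "('a \<times> 'b) measure"
  assumes inv: "cyclically_invariant M1 M2 \<pi> R" and sets_R: "sets R = sets (M1 \<Otimes>\<^sub>M M2)"
    and ne: "space M1 \<noteq> {}" "space M2 \<noteq> {}"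
  obtains f g where "f \<in> borel_measurable M1" "g \<in> borel_measurable M2"
    "\<And>x. 0 < f x" "\<And>y. 0 < g y" "\<pi> = density R (\<lambda>z. ennreal (f (fst z) * g (snd z)))"
proof -
  note [measurable_cong] = sets_R
  obtain F where F: "F \<in> borel_measurable R" "density R (\<lambda>z. ennreal (F z)) = \<pi>" and pos: "\<And>z. 0 < F z"
    and cyc: "\<And>(k::nat) x y. (\<Prod>i=1..k. F (x i, y i)) = (\<Prod>i=1..k. F (x i, if i = k then y 1 else y (i + 1)))"
    using inv unfolding cyclically_invariant_def density_version_def by blast
  note [measurable] = F(1)
  obtain x0 y0 where x0y0: "x0 \<in> space M1" "y0 \<in> space M2" using ne by blast
  note [measurable] = x0y0
  have swap: "F (x, y) * F (x0, y0) = F (x, y0) * F (x0, y)" for x y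
    using cyc[of "\<lambda>i. if i = 1 then x else x0" "\<lambda>i. if i = 1 then y else y0" 2]
    by (simp add: numeral_2_eq_2 prod.atLeast_Suc_atMost_Suc_shift)
  define f where "f x = F (x, y0)" for x
  define g where "g y = F (x0, y) / F (x0, y0)" for y
  have eq: "F z = f (fst z) * g (snd z)" for z
    using swap[of "fst z" "snd z"] pos[of "(x0, y0)"] by (simp add: f_def g_def field_simps)
  show thesis
  proof (rule that[of f g])
    show "f \<in> borel_measurable M1" "g \<in> borel_measurable M2"
      unfolding f_def[abs_def] g_def[abs_def] by measurable
    show "0 < f x" "0 < g y" for x y using pos by (auto simp: f_def g_def)
    show "\<pi> = density R (\<lambda>z. ennreal (f (fst z) * g (snd z)))"
      unfolding F(2)[symmetric] eq ..
  qed
qed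

lemma couplings_nn_integral:
  assumes \<pi>: "\<pi> \<in> couplings \<mu> \<nu>"
  shows "s \<in> borel_measurable borel \<Longrightarrow> (\<integral>\<^sup>+z. s (fst z) \<partial>\<pi>) = (\<integral>\<^sup>+x. s x \<partial>\<mu>)"
    and "s' \<in> borel_measurable borel \<Longrightarrow> (\<integral>\<^sup>+z. s' (snd z) \<partial>\<pi>) = (\<integral>\<^sup>+y. s' y \<partial>\<nu>)"
proof -
  have [measurable_cong]: "sets \<pi> = sets borel" and d: "distr \<pi> borel fst = \<mu>" "distr \<pi> borel snd = \<nu>"
    using \<pi> by (auto simp: couplings_def borel_probs_def)
  have [measurable]: "fst \<in> \<pi> \<rightarrow>\<^sub>M borel" "snd \<in> \<pi> \<rightarrow>\<^sub>M borel"
    by (auto intro!: borel_measurable_continuous_onI continuous_intros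
        simp: measurable_cong_sets[OF \<open>sets \<pi> = sets borel\<close> refl])
  show "(\<integral>\<^sup>+z. s (fst z) \<partial>\<pi>) = (\<integral>\<^sup>+x. s x \<partial>\<mu>)" if "s \<in> borel_measurable borel"
    unfolding d(1)[symmetric] using that by (subst nn_integral_distr) auto
  show "(\<integral>\<^sup>+z. s' (snd z) \<partial>\<pi>) = (\<integral>\<^sup>+y. s' y \<partial>\<nu>)" if "s' \<in> borel_measurable borel"
    unfolding d(2)[symmetric] using that by (subst nn_integral_distr) auto
qed

lemma couplings_integral:
  fixes u :: "_ \<Rightarrow> real" and v :: "_ \<Rightarrow> real"
  assumes \<pi>: "\<pi> \<in> couplings \<mu> \<nu>"
  shows "u \<in> borel_measurable borel \<Longrightarrow> (\<integral>z. u (fst z) \<partial>\<pi>) = (\<integral>x. u x \<partial>\<mu>)"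
    and "v \<in> borel_measurable borel \<Longrightarrow> (\<integral>z. v (snd z) \<partial>\<pi>) = (\<integral>y. v y \<partial>\<nu>)"
proof -
  have [measurable_cong]: "sets \<pi> = sets borel" and d: "distr \<pi> borel fst = \<mu>" "distr \<pi> borel snd = \<nu>"
    using \<pi> by (auto simp: couplings_def borel_probs_def)
  have [measurable]: "fst \<in> \<pi> \<rightarrow>\<^sub>M borel" "snd \<in> \<pi> \<rightarrow>\<^sub>M borel"
    by (auto intro!: borel_measurable_continuous_onI continuous_intros
        simp: measurable_cong_sets[OF \<open>sets \<pi> = sets borel\<close> refl])
  show "(\<integral>z. u (fst z) \<partial>\<pi>) = (\<integral>x. u x \<partial>\<mu>)" if "u \<in> borel_measurable borel"
    unfolding d(1)[symmetric] using that by (subst integral_distr) auto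
  show "(\<integral>z. v (snd z) \<partial>\<pi>) = (\<integral>y. v y \<partial>\<nu>)" if "v \<in> borel_measurable borel"
    unfolding d(2)[symmetric] using that by (subst integral_distr) auto
qed

lemma coupling_of_scaling:
  fixes \<mu> :: "'a::second_countable_topology measure" and \<nu> :: "'b::second_countable_topology measure"
  assumes "scaling_kernel \<mu> \<nu> h" and borel: "sets \<mu> = sets borel" "sets \<nu> = sets borel"
    and fg[measurable]: "f \<in> borel_measurable \<mu>" "g \<in> borel_measurable \<nu>"
    and pos: "\<And>x. 0 < f x" "\<And>y. 0 < g y"
    and \<pi>: "\<pi> \<in> couplings \<mu> \<nu>"
      "\<pi> = density (density (\<mu> \<Otimes>\<^sub>M \<nu>) (\<lambda>z. ennreal (h z))) (\<lambda>z. ennreal (f (fst z) * g (snd z)))"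
  shows "submarginals \<mu> \<nu> (scaling_kernel.scaled h f g)"
    and "(\<integral>z. scaling_kernel.scaled h f g z \<partial>(\<mu> \<Otimes>\<^sub>M \<nu>)) = 1"
proof -
  interpret scaling_kernel \<mu> \<nu> h by fact
  let ?P = "\<mu> \<Otimes>\<^sub>M \<nu>"
  have \<pi>_eq: "\<pi> = density ?P (\<lambda>z. ennreal (scaled f g z))"
    unfolding \<pi>(2) using h_pos pos
    by (subst density_density_eq) (auto intro!: density_cong AE_I2 simp: scaled_def ennreal_mult[symmetric] less_imp_le mult_ac)
  have nn: "(\<integral>\<^sup>+z. s z * ennreal (scaled f g z) \<partial>?P) = (\<integral>\<^sup>+z. s z \<partial>\<pi>)" if [measurable]: "s \<in> borel_measurable ?P" for s
    unfolding \<pi>_eq by (subst nn_integral_density) (auto simp: mult.commute)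
  have nonneg: "0 \<le> scaled f g z" for z using pos h_pos by (simp add: scaled_def less_imp_le)
  show sub: "submarginals \<mu> \<nu> (scaled f g)"
    unfolding submarginals_def
  proof (intro conjI ballI allI nonneg)
    show "scaled f g \<in> borel_measurable ?P" by measurable
    show "(\<integral>\<^sup>+z. s (fst z) * ennreal (scaled f g z) \<partial>?P) \<le> (\<integral>\<^sup>+x. s x \<partial>\<mu>)" if [measurable]: "s \<in> borel_measurable \<mu>" for s
      using that borel by (subst nn) (auto simp: couplings_nn_integral(1)[OF \<pi>(1)] cong: measurable_cong_sets)
    show "(\<integral>\<^sup>+z. s (snd z) * ennreal (scaled f g z) \<partial>?P) \<le> (\<integral>\<^sup>+y. s y \<partial>\<nu>)" if [measurable]: "s \<in> borel_measurable \<nu>" for s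
      using that borel by (subst nn) (auto simp: couplings_nn_integral(2)[OF \<pi>(1)] cong: measurable_cong_sets)
  qed
  have "prob_space \<pi>" using \<pi>(1) by (simp add: couplings_def borel_probs_def)
  then have "1 = (\<integral>\<^sup>+z. 1 \<partial>\<pi>)" by (simp add: prob_space.emeasure_space_1)
  also have "\<dots> = (\<integral>\<^sup>+z. ennreal (scaled f g z) \<partial>?P)" by (subst nn[symmetric]) auto
  also have "\<dots> = ennreal (mass f g)" by (rule submarginals_integrable(3)[OF sub])
  finally show "mass f g = 1" by (simp add: ennreal_eq_1)
qed

lemma exists_factorised_coupling:
  fixes \<mu> :: "'a::second_countable_topology measure" and \<nu> :: "'b::second_countable_topology measure"
  assumes K: "scaling_kernel \<mu> \<nu> h" and borel: "sets \<mu> = sets borel" "sets \<nu> = sets borel"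
    and R: "density (\<mu> \<Otimes>\<^sub>M \<nu>) (\<lambda>z. ennreal (h z)) = R"
    and fin1: "\<And>x. x \<in> space \<mu> \<Longrightarrow> (\<integral>\<^sup>+y. ennreal (h (x, y)) \<partial>\<nu>) < \<infinity>"
    and fin2: "\<And>y. y \<in> space \<nu> \<Longrightarrow> (\<integral>\<^sup>+x. ennreal (h (x, y)) \<partial>\<mu>) < \<infinity>"
    and equiv: "mutually_ac R (\<mu> \<Otimes>\<^sub>M \<nu>)"
  obtains \<pi> where "\<pi> \<in> couplings \<mu> \<nu>" "cyclically_invariant \<mu> \<nu> \<pi> R"
proof -
  interpret scaling_kernel \<mu> \<nu> h by fact
  let ?P = "\<mu> \<Otimes>\<^sub>M \<nu>"
  obtain f g where fg[measurable]: "f \<in> borel_measurable \<mu>" "g \<in> borel_measurable \<nu>"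
    and pos: "\<And>x. 0 < f x" "\<And>y. 0 < g y"
    and m1: "\<And>A. A \<in> sets \<mu> \<Longrightarrow>
      (\<integral>\<^sup>+z. indicator A (fst z) * ennreal (scaled f g z) \<partial>?P) = emeasure \<mu> A"
    and m2: "\<And>B. B \<in> sets \<nu> \<Longrightarrow>
      (\<integral>\<^sup>+z. indicator B (snd z) * ennreal (scaled f g z) \<partial>?P) = emeasure \<nu> B"
    by (rule scaling_exists[OF fin1 fin2]) (assumption | rule that)+
  have sets_P: "sets ?P = sets borel"
    unfolding borel_prod[symmetric] by (intro sets_pair_measure_cong borel)
  have sets_R[measurable_cong]: "sets R = sets ?P" by (simp add: R[symmetric])
  define r where "r z = f (fst z) * g (snd z)" for z
  have r_pos: "0 < r z" for z using pos by (simp add: r_def)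
  have [measurable]: "r \<in> borel_measurable R" "r \<in> borel_measurable ?P" unfolding r_def[abs_def] by measurable
  define \<pi> where "\<pi> = density R (\<lambda>z. ennreal (r z))"
  have sets_\<pi>: "sets \<pi> = sets ?P" by (simp add: \<pi>_def sets_R)
  have \<pi>_eq: "\<pi> = density ?P (\<lambda>z. ennreal (scaled f g z))"
    unfolding \<pi>_def R[symmetric] using h_pos r_pos
    by (subst density_density_eq) (auto intro!: density_cong AE_I2 simp: scaled_def r_def ennreal_mult[symmetric] less_imp_le mult_ac)
  have em: "emeasure \<pi> A = (\<integral>\<^sup>+z. indicator A z * ennreal (scaled f g z) \<partial>?P)" if "A \<in> sets ?P" for A
    unfolding \<pi>_eq using that by (subst emeasure_density) (auto simp: mult.commute)
  have space: "space \<mu> = UNIV" "space \<nu> = UNIV" "space \<pi> = UNIV"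
    using sets_eq_imp_space_eq[OF borel(1)] sets_eq_imp_space_eq[OF borel(2)]
      sets_eq_imp_space_eq[OF sets_\<pi>] sets_eq_imp_space_eq[OF sets_P] by auto
  have d1: "distr \<pi> borel fst = \<mu>"
  proof (rule measure_eqI)
    fix A assume "A \<in> sets (distr \<pi> borel fst)"
    then have A: "A \<in> sets \<mu>" by (simp add: borel)
    have "emeasure (distr \<pi> borel fst) A = emeasure \<pi> (A \<times> UNIV)"
    proof (subst emeasure_distr)
      show "fst \<in> \<pi> \<rightarrow>\<^sub>M borel"
        unfolding measurable_cong_sets[OF sets_\<pi> borel(1)[symmetric]] by measurable
      show "emeasure \<pi> (fst -` A \<inter> space \<pi>) = emeasure \<pi> (A \<times> UNIV)"
        by (rule arg_cong[where f="emeasure \<pi>"]) (auto simp: space)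
    qed (use A borel in auto)
    also have "\<dots> = (\<integral>\<^sup>+z. indicator A (fst z) * ennreal (scaled f g z) \<partial>?P)"
      using A sets.top[of \<nu>] by (subst em) (auto simp: space indicator_def intro!: nn_integral_cong)
    finally show "emeasure (distr \<pi> borel fst) A = emeasure \<mu> A" by (simp add: m1[OF A])
  qed (simp add: borel)
  have d2: "distr \<pi> borel snd = \<nu>"
  proof (rule measure_eqI)
    fix B assume "B \<in> sets (distr \<pi> borel snd)"
    then have B: "B \<in> sets \<nu>" by (simp add: borel)
    have "emeasure (distr \<pi> borel snd) B = emeasure \<pi> (UNIV \<times> B)"
    proof (subst emeasure_distr)
      show "snd \<in> \<pi> \<rightarrow>\<^sub>M borel"
        unfolding measurable_cong_sets[OF sets_\<pi> borel(2)[symmetric]] by measurable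
      show "emeasure \<pi> (snd -` B \<inter> space \<pi>) = emeasure \<pi> (UNIV \<times> B)"
        by (rule arg_cong[where f="emeasure \<pi>"]) (auto simp: space)
    qed (use B borel in auto)
    also have "\<dots> = (\<integral>\<^sup>+z. indicator B (snd z) * ennreal (scaled f g z) \<partial>?P)"
      using B sets.top[of \<mu>] by (subst em) (auto simp: space indicator_def intro!: nn_integral_cong)
    finally show "emeasure (distr \<pi> borel snd) B = emeasure \<nu> B" by (simp add: m2[OF B])
  qed (simp add: borel)
  have "emeasure \<pi> (space \<pi>) = (\<integral>\<^sup>+z. indicator (space \<mu>) (fst z) * ennreal (scaled f g z) \<partial>?P)"
    using sets.top[of \<pi>] by (subst em) (auto simp: space sets_\<pi>[symmetric])
  also have "\<dots> = 1" by (simp add: m1 M1.emeasure_space_1)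
  finally have "prob_space \<pi>" by (rule prob_spaceI)
  then have "\<pi> \<in> couplings \<mu> \<nu>"
    using d1 d2 by (simp add: couplings_def borel_probs_def sets_\<pi> sets_P)
  moreover have "cyclically_invariant \<mu> \<nu> \<pi> R"
    unfolding cyclically_invariant_def
  proof (intro conjI equiv exI[of _ r] allI r_pos)
    have "absolutely_continuous R \<pi>"
      unfolding \<pi>_def by (rule absolutely_continuousI_density) measurable
    moreover have "absolutely_continuous \<pi> R"
      unfolding absolutely_continuous_def
    proof
      fix N assume "N \<in> null_sets \<pi>"
      then have "N \<in> sets R \<and> (AE z in R. z \<in> N \<longrightarrow> ennreal (r z) = 0)"
        unfolding \<pi>_def by (subst (asm) null_sets_density_iff) auto
      then show "N \<in> null_sets R"
        using r_pos by (auto simp: AE_iff_null_sets not_le[symmetric] ennreal_eq_0_iff)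
    qed
    ultimately show "mutually_ac \<pi> R" by (simp add: mutually_ac_def)
    show "density_version r \<pi> R"
      unfolding density_version_def using r_pos by (auto simp: \<pi>_def less_imp_le)
    show "(\<Prod>i=1..k. r (x i, y i)) = (\<Prod>i=1..k. r (x i, if i = k then y 1 else y (i + 1)))"
      for k :: nat and x y
      unfolding r_def fst_conv snd_conv by (rule cyclic_product_factorised)
  qed
  ultimately show thesis by (rule that)
qed

text \<open>A competitor of finite entropy has a density with respect to \<open>R\<close>, so the entropy gap applies. It is the
integral of a nonnegative function that vanishes only where the two densities agree.\<close>

lemma factorised_coupling_minimises:
  fixes \<mu> :: "'a::second_countable_topology measure" and \<nu> :: "'b::second_countable_topology measure"
  assumes R: "prob_space R" and sets_R: "sets R = sets borel"
    and borel: "sets \<mu> = sets borel" "sets \<nu> = sets borel"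
    and fg: "f \<in> borel_measurable \<mu>" "g \<in> borel_measurable \<nu>"
    and pos: "\<And>x. 0 < f x" "\<And>y. 0 < g y"
    and \<pi>: "\<pi> \<in> couplings \<mu> \<nu>" "\<pi> = density R (\<lambda>z. ennreal (f (fst z) * g (snd z)))"
    and \<pi>': "\<pi>' \<in> couplings \<mu> \<nu>" "relative_entropy \<pi>' R < \<infinity>"
  shows "relative_entropy \<pi> R < \<infinity>" "relative_entropy \<pi> R \<le> relative_entropy \<pi>' R"
    and "relative_entropy \<pi> R = relative_entropy \<pi>' R \<Longrightarrow> \<pi>' = \<pi>"
proof -
  interpret R: prob_space R by fact
  interpret \<pi>': prob_space \<pi>' using \<pi>'(1) by (simp add: couplings_def borel_probs_def)
  have sets_R': "sets R = sets (\<mu> \<Otimes>\<^sub>M \<nu>)"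
    unfolding sets_R borel_prod[symmetric] by (intro sets_pair_measure_cong borel[symmetric])
  note [measurable_cong] = sets_R'
  note [measurable] = fg
  define r where "r z = f (fst z) * g (snd z)" for z
  have [measurable]: "r \<in> borel_measurable R" unfolding r_def[abs_def] by measurable
  have r_pos: "0 < r z" for z using pos by (simp add: r_def)
  have \<pi>_r: "\<pi> = density R (\<lambda>z. ennreal (r z))" by (simp add: \<pi>(2) r_def)
  have ac: "absolutely_continuous R \<pi>'"
    using \<pi>'(2) by (auto simp: relative_entropy_def split: if_splits)
  have sets_\<pi>': "sets \<pi>' = sets R" using \<pi>'(1) by (simp add: couplings_def borel_probs_def sets_R)
  obtain r' where r'1[measurable]: "r' \<in> borel_measurable R"
    and RN: "AE z in R. RN_deriv R \<pi>' z = ennreal (r' z)"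
    and "AE z in \<pi>'. 0 < r' z" and r'2: "\<And>z. 0 \<le> r' z"
    by (rule R.real_RN_deriv[OF \<pi>'.finite_measure_axioms ac sets_\<pi>']) (rule that)
  note r' = r'1 r'2
  have \<pi>'_r: "\<pi>' = density R (\<lambda>z. ennreal (r' z))"
    by (rule trans[OF R.density_RN_deriv[OF ac sets_\<pi>', symmetric] density_cong[OF _ _ RN]]) measurable
  have mass: "integrable R p \<and> (\<integral>z. p z \<partial>R) = 1"
    if p[measurable]: "p \<in> borel_measurable R" and p0: "\<And>z. 0 \<le> p z" and d: "q = density R (\<lambda>z. ennreal (p z))"
      and q: "q \<in> couplings \<mu> \<nu>" for p q
  proof -
    have "prob_space q" using q by (simp add: couplings_def borel_probs_def)
    then have "emeasure q (space q) = 1" by (rule prob_space.emeasure_space_1)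
    then have 1: "(\<integral>\<^sup>+z. ennreal (p z) \<partial>R) = ennreal 1"
      unfolding d by (simp add: emeasure_density cong: nn_integral_cong)
    have "integrable R p" using 1 p0 by (intro integrableI_nonneg) auto
    moreover have "(\<integral>z. p z \<partial>R) = 1"
      using 1 p0 by (intro integral_eq_nn_integral[THEN trans]) auto
    ultimately show ?thesis by simp
  qed
  have m: "integrable R r" "(\<integral>z. r z \<partial>R) = 1" "integrable R r'" "(\<integral>z. r' z \<partial>R) = 1"
    using mass[OF _ _ \<pi>_r \<pi>(1)] mass[OF _ _ \<pi>'_r \<pi>'(1)] r' r_pos by (auto simp: less_imp_le)
  have meas_borel: "u \<in> borel_measurable \<mu> \<longleftrightarrow> u \<in> borel_measurable borel"
    "v \<in> borel_measurable \<nu> \<longleftrightarrow> v \<in> borel_measurable borel" for u :: "'a \<Rightarrow> real" and v :: "'b \<Rightarrow> real"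
    by (simp_all cong: measurable_cong_sets add: borel)
  have int1: "(\<integral>z. r z * u (fst z) \<partial>R) = (\<integral>z. r' z * u (fst z) \<partial>R)"
    if [measurable]: "u \<in> borel_measurable \<mu>" for u
  proof -
    have "(\<integral>z. r z * u (fst z) \<partial>R) = (\<integral>z. u (fst z) \<partial>\<pi>)"
      unfolding \<pi>_r using r_pos by (subst integral_density) (auto simp: less_imp_le)
    also have "\<dots> = (\<integral>z. u (fst z) \<partial>\<pi>')"
      using that by (simp add: couplings_integral(1)[OF \<pi>(1)] couplings_integral(1)[OF \<pi>'(1)] meas_borel)
    also have "\<dots> = (\<integral>z. r' z * u (fst z) \<partial>R)"
      unfolding \<pi>'_r using r' by (subst integral_density) auto
    finally show ?thesis .
  qed
  have int2: "(\<integral>z. r z * v (snd z) \<partial>R) = (\<integral>z. r' z * v (snd z) \<partial>R)"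
    if [measurable]: "v \<in> borel_measurable \<nu>" for v
  proof -
    have "(\<integral>z. r z * v (snd z) \<partial>R) = (\<integral>z. v (snd z) \<partial>\<pi>)"
      unfolding \<pi>_r using r_pos by (subst integral_density) (auto simp: less_imp_le)
    also have "\<dots> = (\<integral>z. v (snd z) \<partial>\<pi>')"
      using that by (simp add: couplings_integral(2)[OF \<pi>(1)] couplings_integral(2)[OF \<pi>'(1)] meas_borel)
    also have "\<dots> = (\<integral>z. r' z * v (snd z) \<partial>R)"
      unfolding \<pi>'_r using r' by (subst integral_density) auto
    finally show ?thesis .
  qed
  have fin: "integrable R (\<lambda>z. r' z * ln (r' z))"
    using \<pi>'(2) unfolding \<pi>'_r relative_entropy_density(1)[OF R r'] .
  note gap = entropy_gap[OF R sets_R' fg r'(1) pos r'(2) m[unfolded r_def] int1[unfolded r_def] int2[unfolded r_def] fin,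
      folded r_def]
  have ent: "relative_entropy \<pi> R = ereal (\<integral>z. r z * ln (r z) \<partial>R)"
    unfolding \<pi>_r using gap(1) r_pos by (intro relative_entropy_density(2)[OF R]) (auto simp: less_imp_le)
  have ent': "relative_entropy \<pi>' R = ereal (\<integral>z. r' z * ln (r' z) \<partial>R)"
    unfolding \<pi>'_r by (intro relative_entropy_density(2)[OF R r' fin])
  have breg: "0 \<le> bregman (r' z) (ln (r z))" for z by (rule bregman_nonneg[OF r'(2)])
  then have breg_int: "0 \<le> (\<integral>z. bregman (r' z) (ln (r z)) \<partial>R)" by (intro integral_nonneg_AE) auto
  show "relative_entropy \<pi> R < \<infinity>" unfolding ent by simp
  show "relative_entropy \<pi> R \<le> relative_entropy \<pi>' R"
    unfolding ent ent' using gap(3) breg_int by simp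
  assume "relative_entropy \<pi> R = relative_entropy \<pi>' R"
  then have "(\<integral>z. bregman (r' z) (ln (r z)) \<partial>R) = 0"
    unfolding ent ent' using gap(3) breg_int by simp
  then have "AE z in R. bregman (r' z) (ln (r z)) = 0"
    using gap(2) breg by (subst (asm) integral_nonneg_eq_0_iff_AE) auto
  then have "AE z in R. r' z = r z"
  proof eventually_elim
    case (elim z)
    show ?case using bregman_eq_0[OF r'(2) elim] r_pos[of z] by simp
  qed
  then show "\<pi>' = \<pi>" unfolding \<pi>_r \<pi>'_r by (intro density_cong) auto
qed

theorem theorem2p4:
  fixes \<mu> :: "'a::polish_space measure"
    and \<nu> :: "'b::polish_space measure"
    and R :: "('a \<times> 'b) measure"
  assumes diff_X: "differentiation_of_measures (ball :: 'a \<Rightarrow> real \<Rightarrow> 'a set)"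
    and diff_XY: "differentiation_of_measures (max_ball :: 'a \<times> 'b \<Rightarrow> real \<Rightarrow> ('a \<times> 'b) set)"
    and mu: "\<mu> \<in> borel_probs"
    and nu: "\<nu> \<in> borel_probs"
    and R: "R \<in> borel_probs"
    and R_equiv: "mutually_ac R (\<mu> \<Otimes>\<^sub>M \<nu>)"
    and R_cont: "\<exists>h. continuous_on UNIV h \<and> density_version h R (\<mu> \<Otimes>\<^sub>M \<nu>)"
  shows "(\<exists>!\<pi>. \<pi> \<in> couplings \<mu> \<nu> \<and> cyclically_invariant \<mu> \<nu> \<pi> R) \<and>
    (\<forall>\<pi>. \<pi> \<in> couplings \<mu> \<nu> \<and> cyclically_invariant \<mu> \<nu> \<pi> R \<longrightarrow>
       bridge_finite \<mu> \<nu> R \<longrightarrow> bridge_minimizers \<mu> \<nu> R = {\<pi>})"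
proof -
  have borel: "sets \<mu> = sets borel" "sets \<nu> = sets borel" and sets_R: "sets R = sets borel"
    and prob: "prob_space \<mu>" "prob_space \<nu>" "prob_space R"
    using mu nu R by (auto simp: borel_probs_def)
  have sets_R': "sets R = sets (\<mu> \<Otimes>\<^sub>M \<nu>)"
    unfolding sets_R borel_prod[symmetric] by (intro sets_pair_measure_cong borel[symmetric])
  have ne: "space \<mu> \<noteq> {}" "space \<nu> \<noteq> {}"
    using sets_eq_imp_space_eq[OF borel(1)] sets_eq_imp_space_eq[OF borel(2)] by auto
  interpret \<mu>: prob_space \<mu> by fact
  interpret \<nu>: prob_space \<nu> by fact
  interpret pair_prob_space \<mu> \<nu> ..
  obtain h0 where h0: "h0 \<in> borel_measurable (\<mu> \<Otimes>\<^sub>M \<nu>)" "density (\<mu> \<Otimes>\<^sub>M \<nu>) (\<lambda>z. ennreal (h0 z)) = R"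
    using R_cont by (auto simp: density_version_def)
  have ac: "absolutely_continuous R (\<mu> \<Otimes>\<^sub>M \<nu>)" using R_equiv by (simp add: mutually_ac_def)
  obtain h where K: "scaling_kernel \<mu> \<nu> h" and Rh: "density (\<mu> \<Otimes>\<^sub>M \<nu>) (\<lambda>z. ennreal (h z)) = R"
    and fin1: "\<And>x. x \<in> space \<mu> \<Longrightarrow> (\<integral>\<^sup>+y. ennreal (h (x, y)) \<partial>\<nu>) < \<infinity>"
    and fin2: "\<And>y. y \<in> space \<nu> \<Longrightarrow> (\<integral>\<^sup>+x. ennreal (h (x, y)) \<partial>\<mu>) < \<infinity>"
    by (rule positive_kernel_version[OF h0 prob(3) ac]) (rule that)
  interpret scaling_kernel \<mu> \<nu> h by fact
  have unique: "\<pi> = \<pi>'"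
    if \<pi>: "\<pi> \<in> couplings \<mu> \<nu>" "cyclically_invariant \<mu> \<nu> \<pi> R"
      and \<pi>': "\<pi>' \<in> couplings \<mu> \<nu>" "cyclically_invariant \<mu> \<nu> \<pi>' R" for \<pi> \<pi>'
  proof -
    obtain f g where fg: "f \<in> borel_measurable \<mu>" "g \<in> borel_measurable \<nu>" "\<And>x. 0 < f x" "\<And>y. 0 < g y"
      and d: "\<pi> = density R (\<lambda>z. ennreal (f (fst z) * g (snd z)))"
      by (rule cyclically_invariant_imp_factorised[OF \<pi>(2) sets_R' ne]) (rule that)
    obtain f' g' where fg': "f' \<in> borel_measurable \<mu>" "g' \<in> borel_measurable \<nu>" "\<And>x. 0 < f' x" "\<And>y. 0 < g' y"
      and d': "\<pi>' = density R (\<lambda>z. ennreal (f' (fst z) * g' (snd z)))"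
      by (rule cyclically_invariant_imp_factorised[OF \<pi>'(2) sets_R' ne]) (rule that)
    note [measurable] = fg(1,2) fg'(1,2)
    have "AE z in \<mu> \<Otimes>\<^sub>M \<nu>. f (fst z) * g (snd z) = f' (fst z) * g' (snd z)"
      using coupling_of_scaling[OF K borel fg \<pi>(1) d[folded Rh]]
        coupling_of_scaling[OF K borel fg' \<pi>'(1) d'[folded Rh]] fg fg'
      by (intro scaling_unique) auto
    then have "AE z in R. f (fst z) * g (snd z) = f' (fst z) * g' (snd z)"
      using R_equiv sets_R' by (auto simp: mutually_ac_def intro: absolutely_continuous_AE)
    then show ?thesis
      unfolding d d' using sets_R' by (intro density_cong) (auto cong: measurable_cong_sets)
  qed
  have exists: "\<exists>\<pi>. \<pi> \<in> couplings \<mu> \<nu> \<and> cyclically_invariant \<mu> \<nu> \<pi> R"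
    by (rule exists_factorised_coupling[OF K borel Rh fin1 fin2 R_equiv]) blast+
  have minimizer: "bridge_minimizers \<mu> \<nu> R = {\<pi>}"
    if \<pi>: "\<pi> \<in> couplings \<mu> \<nu>" "cyclically_invariant \<mu> \<nu> \<pi> R" and fin: "bridge_finite \<mu> \<nu> R" for \<pi>
  proof -
    obtain f g where fg: "f \<in> borel_measurable \<mu>" "g \<in> borel_measurable \<nu>" "\<And>x. 0 < f x" "\<And>y. 0 < g y"
      and d: "\<pi> = density R (\<lambda>z. ennreal (f (fst z) * g (snd z)))"
      by (rule cyclically_invariant_imp_factorised[OF \<pi>(2) sets_R' ne]) (rule that)
    note opt = factorised_coupling_minimises[OF prob(3) sets_R borel fg \<pi>(1) d]
    obtain \<pi>0 where "\<pi>0 \<in> couplings \<mu> \<nu>" "relative_entropy \<pi>0 R < \<infinity>"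
      using fin by (auto simp: bridge_finite_def)
    then have fin_\<pi>: "relative_entropy \<pi> R < \<infinity>" by (rule opt(1))
    have le: "relative_entropy \<pi> R \<le> relative_entropy \<pi>' R" if "\<pi>' \<in> couplings \<mu> \<nu>" for \<pi>'
      using opt(2)[OF that] by (cases "relative_entropy \<pi>' R < \<infinity>") auto
    have attained: "bridge_value \<mu> \<nu> R = relative_entropy \<pi> R"
      unfolding bridge_value_def using \<pi>(1) le by (intro antisym INF_lower INF_greatest)
    show ?thesis
    proof (intro equalityI subsetI)
      fix \<pi>' assume "\<pi>' \<in> bridge_minimizers \<mu> \<nu> R"
      then have "\<pi>' \<in> couplings \<mu> \<nu>" "relative_entropy \<pi> R = relative_entropy \<pi>' R"
        by (auto simp: bridge_minimizers_def attained)
      then show "\<pi>' \<in> {\<pi>}" using opt(3)[of \<pi>'] fin_\<pi> by auto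
    next
      fix \<pi>' assume "\<pi>' \<in> {\<pi>}"
      then show "\<pi>' \<in> bridge_minimizers \<mu> \<nu> R" using \<pi>(1) attained by (simp add: bridge_minimizers_def)
    qed
  qed
  show ?thesis using exists unique minimizer by blast
qed

end
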